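(* Let $q=2^{2e+1}>2$ and let $s$ be an integer with $1<s\le\sqrt{q/2}-1$. Then an ${\rm O}^+(8,q)$-space has a maximal orthogonal partial spread of size $q^2-sq+2s-1$, and each such is a maximal symplectic partial spread. In particular, for $q=2^{2e+1}>2$ there is a maximal symplectic partial spread of an ${\rm Sp}(8,q)$-space of size $q^2-\sqrt{q^3/2}+q+\sqrt{2q}-3$.
   Context: An ${\rm O}^+(8,q)$-space is an $8$-dimensional $\mathbb{F}_q$-space with a nondegenerate quadratic form $Q$ of plus type; for $q$ even its polar form $f(u,v)=Q(u+v)-Q(u)-Q(v)$ is nondegenerate alternating. An ${\rm Sp}(8,q)$-space is an $8$-dimensional $\mathbb{F}_q$-space with a nondegenerate alternating form. An orthogonal (resp. symplectic) partial spread is a set of $4$-dimensional subspaces on which $Q$ (resp. the alternating form) vanishes, pairwise meeting only in $0$; maximal means not properly contained in another such. *)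

theory Defs
  imports Complex_Main "HOL-Library.Cardinality"
begin

definition polar :: "('v::ab_group_add \<Rightarrow> 'k::field) \<Rightarrow> 'v \<Rightarrow> 'v \<Rightarrow> 'k" where
  "polar Q u v = Q (u + v) - Q u - Q v"

definition alternating :: "('v \<Rightarrow> 'v \<Rightarrow> 'k::zero) \<Rightarrow> bool" where
  "alternating B \<longleftrightarrow> (\<forall>v. B v v = 0)"

definition nondegenerate :: "('v::zero \<Rightarrow> 'v \<Rightarrow> 'k::zero) \<Rightarrow> bool" where
  "nondegenerate B \<longleftrightarrow> (\<forall>u. (\<forall>v. B u v = 0) \<longrightarrow> u = 0)"

definition totally_singular :: "('v \<Rightarrow> 'k::zero) \<Rightarrow> 'v set \<Rightarrow> bool" where
  "totally_singular Q U \<longleftrightarrow> (\<forall>u\<in>U. Q u = 0)"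

definition totally_isotropic :: "('v \<Rightarrow> 'v \<Rightarrow> 'k::zero) \<Rightarrow> 'v set \<Rightarrow> bool" where
  "totally_isotropic B U \<longleftrightarrow> (\<forall>u\<in>U. \<forall>v\<in>U. B u v = 0)"

definition bilinear_form ::
  "('a::field \<Rightarrow> 'b::ab_group_add \<Rightarrow> 'b) \<Rightarrow> ('b \<Rightarrow> 'b \<Rightarrow> 'a) \<Rightarrow> bool" where
  "bilinear_form scale B \<longleftrightarrow>
     (\<forall>u. Vector_Spaces.linear scale (*) (\<lambda>v. B u v)) \<and>
     (\<forall>v. Vector_Spaces.linear scale (*) (\<lambda>u. B u v))"

definition quadratic_form ::
  "('a::field \<Rightarrow> 'b::ab_group_add \<Rightarrow> 'b) \<Rightarrow> ('b \<Rightarrow> 'a) \<Rightarrow> bool" where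
  "quadratic_form scale Q \<longleftrightarrow>
     (\<forall>a v. Q (scale a v) = a\<^sup>2 * Q v) \<and> bilinear_form scale (polar Q)"

text \<open>
  Nondegeneracy in the sense valid in every characteristic: the radical of the polar form
  contains no nonzero singular vector.
\<close>

definition nondegenerate_quadratic_form ::
  "('a::field \<Rightarrow> 'b::ab_group_add \<Rightarrow> 'b) \<Rightarrow> ('b \<Rightarrow> 'a) \<Rightarrow> bool" where
  "nondegenerate_quadratic_form scale Q \<longleftrightarrow>
     quadratic_form scale Q \<and> (\<forall>u. Q u = 0 \<and> (\<forall>v. polar Q u v = 0) \<longrightarrow> u = 0)"

text \<open>Only meaningful in finite dimension, where the set of dimensions below is finite.\<close>

definition witt_index ::
  "('a::field \<Rightarrow> 'b::ab_group_add \<Rightarrow> 'b) \<Rightarrow> ('b \<Rightarrow> 'a) \<Rightarrow> nat" where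
  "witt_index scale Q = Max {vector_space.dim scale U | U. module.subspace scale U \<and> totally_singular Q U}"

definition plus_type ::
  "('a::field \<Rightarrow> 'b::ab_group_add \<Rightarrow> 'b) \<Rightarrow> ('b \<Rightarrow> 'a) \<Rightarrow> bool" where
  "plus_type scale Q \<longleftrightarrow> vector_space.dim scale UNIV = 2 * witt_index scale Q"

definition orthogonal_partial_spread ::
  "('a::field \<Rightarrow> 'b::ab_group_add \<Rightarrow> 'b) \<Rightarrow> ('b \<Rightarrow> 'a) \<Rightarrow> 'b set set \<Rightarrow> bool" where
  "orthogonal_partial_spread scale Q \<Sigma> \<longleftrightarrow>
     (\<forall>U\<in>\<Sigma>. module.subspace scale U \<and> vector_space.dim scale U = 4 \<and> totally_singular Q U) \<and>
     (\<forall>U\<in>\<Sigma>. \<forall>W\<in>\<Sigma>. U \<noteq> W \<longrightarrow> U \<inter> W = {0})"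

definition symplectic_partial_spread ::
  "('a::field \<Rightarrow> 'b::ab_group_add \<Rightarrow> 'b) \<Rightarrow> ('b \<Rightarrow> 'b \<Rightarrow> 'a) \<Rightarrow> 'b set set \<Rightarrow> bool" where
  "symplectic_partial_spread scale B \<Sigma> \<longleftrightarrow>
     (\<forall>U\<in>\<Sigma>. module.subspace scale U \<and> vector_space.dim scale U = 4 \<and> totally_isotropic B U) \<and>
     (\<forall>U\<in>\<Sigma>. \<forall>W\<in>\<Sigma>. U \<noteq> W \<longrightarrow> U \<inter> W = {0})"

definition maximal_orthogonal_partial_spread ::
  "('a::field \<Rightarrow> 'b::ab_group_add \<Rightarrow> 'b) \<Rightarrow> ('b \<Rightarrow> 'a) \<Rightarrow> 'b set set \<Rightarrow> bool" where
  "maximal_orthogonal_partial_spread scale Q \<Sigma> \<longleftrightarrow>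
     orthogonal_partial_spread scale Q \<Sigma> \<and> \<not> (\<exists>\<Sigma>'. orthogonal_partial_spread scale Q \<Sigma>' \<and> \<Sigma> \<subset> \<Sigma>')"

definition maximal_symplectic_partial_spread ::
  "('a::field \<Rightarrow> 'b::ab_group_add \<Rightarrow> 'b) \<Rightarrow> ('b \<Rightarrow> 'b \<Rightarrow> 'a) \<Rightarrow> 'b set set \<Rightarrow> bool" where
  "maximal_symplectic_partial_spread scale B \<Sigma> \<longleftrightarrow>
     symplectic_partial_spread scale B \<Sigma> \<and> \<not> (\<exists>\<Sigma>'. symplectic_partial_spread scale B \<Sigma>' \<and> \<Sigma> \<subset> \<Sigma>')"

locale O_plus_8_space = vector_space scale
  for scale :: "'k::{field,finite} \<Rightarrow> 'v::ab_group_add \<Rightarrow> 'v" +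
  fixes q :: nat and Q :: "'v \<Rightarrow> 'k"
  assumes card_field: "CARD('k) = q"
    and dim_space: "vector_space.dim scale UNIV = 8"
    and nondegenerate_form: "nondegenerate_quadratic_form scale Q"
    and plus: "plus_type scale Q"

locale Sp_8_space = vector_space scale
  for scale :: "'k::{field,finite} \<Rightarrow> 'v::ab_group_add \<Rightarrow> 'v" +
  fixes q :: nat and B :: "'v \<Rightarrow> 'v \<Rightarrow> 'k"
  assumes card_field: "CARD('k) = q"
    and dim_space: "vector_space.dim scale UNIV = 8"
    and bilinear: "bilinear_form scale B"
    and alternating_form: "alternating B"
    and nondegenerate_form: "nondegenerate B"

end

theory Submission
  imports Defs "HOL-Analysis.Analysis"
begin

text \<open>
  Partial spreads containing a fixed totally singular 4-space \<open>W\<close> are sets of graphs of alternating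
  \<open>4 \<times> 4\<close> matrices with pairwise nonzero Pfaffian differences. As the Pfaffian is a hyperbolic quadratic
  form in six variables, this is triality in coordinates: spread members are singular points of
  an \<open>O\<^sup>+(8,q)\<close>-space, pairwise nonperpendicular, with \<open>W\<close> as the point at infinity. Start from the
  \<open>q\<^sup>2 + 1\<close> points of the Suzuki-Tits ovoid, embedded in an \<open>O(5,q)\<close>-subspace. Each circle of the ovoid is its
  intersection with \<open>v\<^sup>\<bottom>\<close> for a singular point \<open>v\<close> of that subspace. Choose \<open>s\<close> circles through two common
  points and replace the \<open>s(q - 1) + 2\<close> points on them by the \<open>s\<close> points \<open>v\<close>.

  A point that could be added would have all its perpendicular ovoid points in the \<open>s\<close> circles. If
  there is only one such point, it lies on one of these circles and the new point is perpendicular to the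
  corresponding \<open>v\<close>. The same holds if they form a circle, which must be one of the \<open>s\<close> circles since
  \<open>2s < q + 1\<close>. Otherwise they form a hyperplane section with at least \<open>q + 1 - 2n\<close> points, where \<open>q = 2n\<^sup>2\<close>, of
  which a circle contains at most \<open>2n\<close>; as \<open>2ns \<le> 2n(n - 1) = q - 2n\<close>, this is impossible.

  Maximality among symplectic partial spreads is automatic: a totally isotropic complement of \<open>W\<close> is
  the graph of a symmetric matrix, and correcting its diagonal by a matrix of rank one gives a
  totally singular 4-space that can also be added.
\<close>

section \<open>Finite fields of order $2n^2$ with $n$ a power of two\<close>

locale char_2 =
  fixes k :: "'k::field itself"
  assumes two_eq_0 [simp]: "(2::'k) = 0"
begin

lemma add_self [simp]: "x + x = (0::'k)"
  using two_eq_0 mult_2[of x] by simp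

lemma add_self_left [simp]: "x + (x + y) = (y::'k)"
  by (simp flip: add.assoc)

lemma minus_eq [simp]: "- x = (x::'k)"
  by (rule minus_unique) simp

lemma diff_eq [simp]: "x - y = x + (y::'k)"
  using diff_conv_add_uminus[of x y] by simp

lemma add_eq_0 [simp]: "x + y = 0 \<longleftrightarrow> x = (y::'k)"
  using eq_neg_iff_add_eq_0[of x y] by simp

lemma sq_add: "(x + y)\<^sup>2 = x\<^sup>2 + (y::'k)\<^sup>2"
  by (simp add: power2_sum)

lemma sq_inj [simp]: "x\<^sup>2 = y\<^sup>2 \<longleftrightarrow> x = (y::'k)"
  using sq_add[of x y] add_eq_0[of "x\<^sup>2" "y\<^sup>2"] by auto

end

text \<open>Multiplication by a nonzero \<open>x\<close> permutes the nonzero elements and so leaves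
  their product unchanged.\<close>

lemma finite_field_power_card:
  fixes x :: "'k::{field,finite}"
  shows "x ^ CARD('k) = x"
proof (cases "x = 0")
  case False
  let ?P = "\<Prod>y\<in>UNIV - {0::'k}. y"
  have bij: "bij_betw (\<lambda>y. x * y) (UNIV - {0}) (UNIV - {0})"
    by (rule bij_betw_byWitness[where f' = "\<lambda>y. y / x"]) (use False in auto)
  have "?P = (\<Prod>y\<in>UNIV - {0}. x * y)"
    using prod.reindex_bij_betw[OF bij, of "\<lambda>y. y"] by simp
  also have "\<dots> = x ^ card (UNIV - {0::'k}) * ?P"
    by (simp add: prod.distrib)
  finally have "x ^ card (UNIV - {0::'k}) = 1"
    by (simp add: prod_zero_iff)
  moreover have "CARD('k) = Suc (card (UNIV - {0::'k}))"
    by (simp add: card_Suc_Diff1)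
  ultimately show ?thesis
    by (metis mult.right_neutral power_Suc)
qed (simp add: zero_power)

text \<open>Translation by 1 permutes the field and preserves the sum of all elements. When the
  order is a power of two, this yields characteristic 2.\<close>

lemma of_nat_card_eq_0: "of_nat CARD('k::{field,finite}) = (0::'k)"
proof -
  have "(\<Sum>x\<in>UNIV. x) = (\<Sum>x\<in>UNIV. x + (1::'k))"
    by (rule sum.reindex_bij_betw[symmetric, OF bij_betw_byWitness[where f' = "\<lambda>y. y - 1"]]) auto
  also have "\<dots> = (\<Sum>x\<in>UNIV. x) + of_nat CARD('k)"
    by (simp add: sum.distrib)
  finally show ?thesis by simp
qed

locale suzuki_field =
  fixes k :: "'k::{field,finite} itself" and e n :: nat
  assumes card_k: "CARD('k) = 2 ^ (2 * e + 1)" and e_pos: "e > 0" and n_def: "n = 2 ^ e"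
begin

lemma card_eq: "CARD('k) = 2 * n * n"
  by (simp add: card_k n_def power_add mult_2 distrib_right)

lemma n_ge_2: "n \<ge> 2"
  using e_pos power_increasing[of 1 e "2::nat"] unfolding n_def by simp

sublocale char_2 k
  by unfold_locales (use of_nat_card_eq_0[where 'k = 'k] in \<open>auto simp: card_k\<close>)

text \<open>The inverse of the Tits automorphism \<open>x \<mapsto> (\<theta> x)\<^sup>2\<close>,
  whose square is the Frobenius map; applied twice, \<open>\<theta>\<close> gives square
  roots.\<close>

definition \<theta> :: "'k \<Rightarrow> 'k" where "\<theta> x = x ^ n"

lemma \<theta>_add: "\<theta> (x + y) = \<theta> x + \<theta> y"
proof -
  have "(x + y) ^ (2 ^ i) = x ^ (2 ^ i) + y ^ (2 ^ i)" for i
    by (induction i) (simp_all add: power_mult sq_add mult.commute[of 2])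
  thus ?thesis by (metis \<theta>_def n_def)
qed

lemma \<theta>_mult: "\<theta> (x * y) = \<theta> x * \<theta> y"
  by (simp add: \<theta>_def power_mult_distrib)

lemma \<theta>_sq: "\<theta> (x\<^sup>2) = (\<theta> x)\<^sup>2"
  by (simp add: power2_eq_square \<theta>_mult)

lemma \<theta>_0 [simp]: "\<theta> 0 = 0"
  using n_ge_2 by (simp add: \<theta>_def)

lemma \<theta>_1 [simp]: "\<theta> 1 = 1"
  by (simp add: \<theta>_def)

lemma \<theta>_divide: "\<theta> (x / y) = \<theta> x / \<theta> y"
  by (simp add: \<theta>_def power_divide)

lemma \<theta>_\<theta>_sq: "(\<theta> (\<theta> x))\<^sup>2 = x"
proof -
  have "(\<theta> (\<theta> x))\<^sup>2 = x ^ CARD('k)"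
    unfolding \<theta>_def card_eq by (simp flip: power_mult add: ac_simps)
  thus ?thesis by (simp add: finite_field_power_card)
qed

lemma \<theta>_eq [simp]: "\<theta> x = \<theta> y \<longleftrightarrow> x = y"
  by (metis \<theta>_\<theta>_sq)

lemma \<theta>_eq_0 [simp]: "\<theta> x = 0 \<longleftrightarrow> x = 0"
  by (metis \<theta>_0 \<theta>_eq)

lemma inj_imp_surj: "inj (f :: 'k \<Rightarrow> 'k) \<Longrightarrow> \<exists>x. f x = y"
  by (metis finite_UNIV_inj_surj finite surjD)

lemma \<theta>_surj: "\<exists>x. \<theta> x = y"
  by (rule inj_imp_surj) (simp add: inj_def)

lemma \<theta>_fixed: "\<theta> x = x \<Longrightarrow> x = 0 \<or> x = 1"
  using \<theta>_\<theta>_sq[of x] by (simp add: power2_eq_square)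

text \<open>Applying \<open>\<theta>\<close> to the equation gives
  \<open>x * \<theta> x = 1\<close>, which cancels from the equation itself.\<close>

lemma \<theta>_sq_mult_eq_1: assumes "(\<theta> x)\<^sup>2 * x = 1" shows "x = 1"
proof -
  have "(\<theta> (\<theta> x))\<^sup>2 * \<theta> x = 1" by (metis assms \<theta>_1 \<theta>_mult \<theta>_sq)
  hence 1: "x * \<theta> x = 1" by (simp add: \<theta>_\<theta>_sq)
  have "(\<theta> x)\<^sup>2 * x = \<theta> x * (x * \<theta> x)" by (simp add: power2_eq_square)
  hence "\<theta> x = 1" using assms 1 by simp
  thus ?thesis using 1 by simp
qed

lemma \<theta>_mult_eq_1: assumes "\<theta> x * x = 1" shows "x = 1"
proof -
  have "\<theta> (\<theta> x) * \<theta> x = \<theta> (\<theta> x * x)" by (simp add: \<theta>_mult)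
  hence "\<theta> (\<theta> x) * \<theta> x = x * \<theta> x" using assms by (simp add: mult.commute)
  moreover have "\<theta> x \<noteq> 0" using assms by auto
  ultimately have "\<theta> (\<theta> x) = x" by simp
  hence "x * x = x" using \<theta>_\<theta>_sq[of x] by (metis power2_eq_square)
  hence "x = 0 \<or> x = 1" by simp
  thus ?thesis using \<open>\<theta> x \<noteq> 0\<close> by auto
qed

lemma nonzero_inj_imp_surj:
  fixes f :: "'k \<Rightarrow> 'k"
  assumes "\<And>x y. x \<noteq> 0 \<Longrightarrow> y \<noteq> 0 \<Longrightarrow> f x = f y \<Longrightarrow> x = y" "\<And>x. x \<noteq> 0 \<Longrightarrow> f x \<noteq> 0" "y \<noteq> 0"
  shows "\<exists>x. x \<noteq> 0 \<and> f x = y"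
proof -
  have "inj_on f (UNIV - {0})" by (rule inj_onI) (blast intro: assms(1))
  moreover have "f ` (UNIV - {0}) \<subseteq> UNIV - {0}"
  proof (rule image_subsetI)
    fix x :: 'k assume "x \<in> UNIV - {0}"
    hence "x \<noteq> 0" by simp
    from assms(2)[OF this] show "f x \<in> UNIV - {0}" by simp
  qed
  ultimately have "f ` (UNIV - {0}) = UNIV - {0}" by (simp add: endo_inj_surj)
  moreover have "y \<in> UNIV - {0}" using assms(3) by simp
  ultimately have "y \<in> f ` (UNIV - {0})" by simp
  thus ?thesis by (auto elim!: imageE)
qed

text \<open>The map \<open>x \<mapsto> \<theta> x / x\<close> is an endomorphism of the
  multiplicative group, injective because \<open>\<theta>\<close> fixes only 0 and 1.\<close>

lemma \<theta>_ratio_surj: assumes "c \<noteq> 0" shows "\<exists>x. x \<noteq> 0 \<and> \<theta> x = c * x"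
proof -
  have "\<exists>x. x \<noteq> 0 \<and> \<theta> x / x = c"
  proof (rule nonzero_inj_imp_surj[OF _ _ assms])
    fix x y :: 'k assume *: "x \<noteq> 0" "y \<noteq> 0" "\<theta> x / x = \<theta> y / y"
    hence "\<theta> (x / y) = x / y" by (simp add: \<theta>_divide field_simps)
    hence "x / y = 1" using * \<theta>_fixed[of "x / y"] by auto
    thus "x = y" using * by simp
  qed auto
  thus ?thesis by (auto simp: field_simps)
qed

lemma \<theta>_mult_self_surj: assumes "c \<noteq> 0" shows "\<exists>x. x \<noteq> 0 \<and> (\<theta> x)\<^sup>2 * x\<^sup>2 = c"
proof (rule nonzero_inj_imp_surj[OF _ _ assms])
  fix x y :: 'k assume *: "x \<noteq> 0" "y \<noteq> 0" "(\<theta> x)\<^sup>2 * x\<^sup>2 = (\<theta> y)\<^sup>2 * y\<^sup>2"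
  hence "\<theta> x * x = \<theta> y * y" by (metis power_mult_distrib sq_inj)
  hence "\<theta> (x / y) * (x / y) = 1" using * by (simp add: \<theta>_divide field_simps)
  hence "x / y = 1" by (rule \<theta>_mult_eq_1)
  thus "x = y" using * by simp
qed auto

section \<open>The Suzuki-Tits ovoid\<close>

text \<open>
  For the quadratic form \<open>ad + bc + r\<^sup>2\<close> on vectors \<open>(a, b, c, d, r)\<close>, the ovoid consists of \<open>(0, 0, 0, 1, 0)\<close> and
  the points \<open>(1, x, y, \<zeta> x y, \<rho> x y)\<close>. The affine point \<open>(x, y)\<close> stands for the latter.
\<close>

definition \<rho> :: "'k \<Rightarrow> 'k \<Rightarrow> 'k" where "\<rho> x y = x * \<theta> x + \<theta> y"

definition \<zeta> :: "'k \<Rightarrow> 'k \<Rightarrow> 'k" where "\<zeta> x y = x * y + (\<rho> x y)\<^sup>2"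

lemma \<rho>_0 [simp]: "\<rho> 0 0 = 0" by (simp add: \<rho>_def)

lemma \<zeta>_0 [simp]: "\<zeta> 0 0 = 0" by (simp add: \<zeta>_def)

text \<open>The map \<open>(x, y) \<mapsto> (x + a, y + b + (\<theta> a)\<^sup>2 * x)\<close> is a
  symmetry of the ovoid fixing infinity and taking the origin to \<open>(a, b)\<close>. The image of
  its last summand under \<open>\<theta>\<close> cancels the cross term
  \<open>a * \<theta> x\<close>.\<close>

lemma \<rho>_translate: "\<rho> (x + a) (y + b + (\<theta> a)\<^sup>2 * x) = \<rho> x y + \<theta> a * x + \<rho> a b"
proof -
  have "\<theta> ((\<theta> a)\<^sup>2 * x) = a * \<theta> x"
    by (simp add: \<theta>_mult \<theta>_sq \<theta>_\<theta>_sq)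
  thus ?thesis unfolding \<rho>_def \<theta>_add by (simp add: algebra_simps)
qed

lemma \<zeta>_translate:
  "\<zeta> (x + a) (y + b + (\<theta> a)\<^sup>2 * x) = \<zeta> x y + (b + a * (\<theta> a)\<^sup>2) * x + a * y + \<zeta> a b"
  unfolding \<zeta>_def \<rho>_translate sq_add power_mult_distrib
  by (simp add: algebra_simps power2_eq_square)

text \<open>The identity behind the inversion of the ovoid; it also forces \<open>\<zeta>\<close> to
  vanish only at the origin.\<close>

lemma \<rho>_mult_\<theta>_\<zeta>: "\<rho> x y * \<theta> (\<zeta> x y) = y * \<theta> y + \<theta> x * \<zeta> x y"
proof -
  have "(\<theta> (\<rho> x y))\<^sup>2 = (\<theta> x)\<^sup>2 * x + y"
    by (simp add: \<rho>_def \<theta>_add \<theta>_mult sq_add power_mult_distrib \<theta>_\<theta>_sq)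
  hence "\<theta> (\<zeta> x y) = \<theta> x * \<theta> y + (\<theta> x)\<^sup>2 * x + y"
    by (simp add: \<zeta>_def \<theta>_add \<theta>_mult \<theta>_sq add.assoc)
  moreover have "\<zeta> x y = x * y + x\<^sup>2 * (\<theta> x)\<^sup>2 + (\<theta> y)\<^sup>2"
    by (simp add: \<zeta>_def \<rho>_def sq_add power_mult_distrib add.assoc)
  ultimately show ?thesis
    by (simp add: \<rho>_def algebra_simps power2_eq_square)
qed

lemma \<zeta>_eq_0 [simp]: "\<zeta> x y = 0 \<longleftrightarrow> x = 0 \<and> y = 0"
proof
  assume *: "\<zeta> x y = 0"
  hence "y = 0" using \<rho>_mult_\<theta>_\<zeta>[of x y] by auto
  thus "x = 0 \<and> y = 0" using * by (auto simp: \<zeta>_def \<rho>_def)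
qed auto

text \<open>Reversing the first four coordinates turns \<open>(1, x, y, \<zeta>, \<rho>)\<close>
  into \<open>(\<zeta>, y, x, 1, \<rho>)\<close>; divided by \<open>\<zeta>\<close>, this is again
  an ovoid point.\<close>

lemma \<rho>_invert:
  assumes "\<zeta> x y \<noteq> 0"
  shows "\<rho> (y / \<zeta> x y) (x / \<zeta> x y) = \<rho> x y / \<zeta> x y"
proof -
  have nz: "\<theta> (\<zeta> x y) \<noteq> 0" using assms by auto
  have "\<rho> (y / \<zeta> x y) (x / \<zeta> x y) = (y * \<theta> y + \<theta> x * \<zeta> x y) / (\<zeta> x y * \<theta> (\<zeta> x y))"
    unfolding \<rho>_def[of "y / _"] \<theta>_divide using assms nz by (simp add: add_divide_distrib)
  thus ?thesis unfolding \<rho>_mult_\<theta>_\<zeta>[symmetric] using nz by simp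
qed

lemma \<zeta>_invert:
  assumes "\<zeta> x y \<noteq> 0"
  shows "\<zeta> (y / \<zeta> x y) (x / \<zeta> x y) = 1 / \<zeta> x y"
proof -
  have "\<zeta> (y / \<zeta> x y) (x / \<zeta> x y) = (x * y + (\<rho> x y)\<^sup>2) / (\<zeta> x y)\<^sup>2"
    unfolding \<zeta>_def[of "y / _"] \<rho>_invert[OF assms] by (simp add: power2_eq_square add_divide_distrib)
  also have "x * y + (\<rho> x y)\<^sup>2 = \<zeta> x y" by (simp add: \<zeta>_def)
  finally show ?thesis using assms by (simp add: power2_eq_square)
qed

definition \<Phi> :: "'k \<Rightarrow> 'k \<Rightarrow> 'k \<Rightarrow> 'k \<Rightarrow> 'k \<Rightarrow> 'k \<times> 'k \<Rightarrow> 'k" where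
  "\<Phi> A B C D E = (\<lambda>(x, y). A + B * x + C * y + D * \<zeta> x y + E * \<rho> x y)"

text \<open>
  Affine part of a hyperplane section; the point at infinity, which belongs to the section when
  \<open>D = 0\<close>, is left out.
\<close>

definition section_of :: "'k \<Rightarrow> 'k \<Rightarrow> 'k \<Rightarrow> 'k \<Rightarrow> 'k \<Rightarrow> ('k \<times> 'k) set" where
  "section_of A B C D E = {p. \<Phi> A B C D E p = 0}"

text \<open>
  The inversion of the ovoid followed by a translation; as a collineation it takes the point at
  infinity to \<open>(a, b)\<close>. It reduces sections through \<open>(a, b)\<close> to sections through infinity, whose
  equations have \<open>D = 0\<close>.
\<close>

definition move :: "'k \<times> 'k \<Rightarrow> 'k \<times> 'k \<Rightarrow> 'k \<times> 'k" where
  "move = (\<lambda>(a, b) (x, y). (y / \<zeta> x y + a, x / \<zeta> x y + b + (\<theta> a)\<^sup>2 * (y / \<zeta> x y)))"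

text \<open>The computation for \<open>\<Phi>_move\<close> without divisions: \<open>z\<close> is
  \<open>\<zeta> x y\<close>, \<open>i\<close> its inverse, and \<open>u\<close>, \<open>v\<close>,
  \<open>s\<close> are \<open>y\<close>, \<open>x\<close>, \<open>\<rho> x y\<close> divided by
  \<open>z\<close>; \<open>t\<close>, \<open>a'\<close>, \<open>z'\<close>, \<open>r'\<close> stand
  for \<open>(\<theta> a)\<^sup>2\<close>, \<open>\<theta> a\<close>, \<open>\<zeta> a b\<close>,
  \<open>\<rho> a b\<close>.\<close>

lemma move_identity:
  fixes z :: "'a :: comm_ring_1"
  assumes "y = u * z" "x = v * z" "1 = i * z" "r = s * z"
  shows "(A + B * (u + a) + C * (v + b + t * u) + D * (i + (b + a * t) * u + a * v + z') + E * (s + a' * u + r')) * z =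
    D + (C + D * a) * x + (B + C * t + D * (b + a * t) + E * a') * y + (A + B * a + C * b + D * z' + E * r') * z + E * r"
proof -
  have "D = D * i * z" using assms(3) by (metis mult.assoc mult.right_neutral)
  hence "D + (C + D * a) * x + (B + C * t + D * (b + a * t) + E * a') * y + (A + B * a + C * b + D * z' + E * r') * z + E * r
    = D * i * z + (C + D * a) * x + (B + C * t + D * (b + a * t) + E * a') * y + (A + B * a + C * b + D * z' + E * r') * z + E * r"
    by simp
  also have "\<dots> = (A + B * (u + a) + C * (v + b + t * u) + D * (i + (b + a * t) * u + a * v + z') + E * (s + a' * u + r')) * z"
    unfolding assms(1,2,4) by (simp add: algebra_simps)
  finally show ?thesis ..
qed

text \<open>The new coefficient of \<open>\<zeta>\<close> is the old value at \<open>(a, b)\<close>,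
  and the new constant term is the old \<open>D\<close>.\<close>

lemma \<Phi>_move:
  assumes "p \<noteq> (0, 0)"
  shows "\<Phi> A B C D E (move (a, b) p) * \<zeta> (fst p) (snd p) =
    \<Phi> D (C + D * a) (B + C * (\<theta> a)\<^sup>2 + D * (b + a * (\<theta> a)\<^sup>2) + E * \<theta> a) (\<Phi> A B C D E (a, b)) E p"
proof -
  obtain x y where p: "p = (x, y)" by (cases p)
  with assms have nz: "\<zeta> x y \<noteq> 0" by auto
  show ?thesis
    unfolding p move_def \<Phi>_def prod.case fst_conv snd_conv \<rho>_translate \<zeta>_translate
      \<rho>_invert[OF nz] \<zeta>_invert[OF nz]
    by (rule move_identity) (use nz in simp_all)
qed

lemma bij_move: "bij_betw (move p) (UNIV - {(0, 0)}) (UNIV - {p})"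
proof (cases p)
  case [simp]: (Pair a b)
  show ?thesis
  \<comment> \<open>The inverse undoes the translation and then applies \<open>move (0, 0)\<close>,
    the inversion itself.\<close>
  proof (rule bij_betw_byWitness[where f' = "\<lambda>(x, y). move (0, 0) (x + a, y + b + (\<theta> a)\<^sup>2 * (x + a))"])
    show "\<forall>r\<in>UNIV - {(0, 0)}. (case move p r of (x, y) \<Rightarrow> move (0, 0) (x + a, y + b + (\<theta> a)\<^sup>2 * (x + a))) = r"
    proof
      fix r :: "'k \<times> 'k" assume r: "r \<in> UNIV - {(0, 0)}"
      obtain x y where [simp]: "r = (x, y)" by (cases r)
      have nz: "\<zeta> x y \<noteq> 0" using r by auto
      thus "(case move p r of (x, y) \<Rightarrow> move (0, 0) (x + a, y + b + (\<theta> a)\<^sup>2 * (x + a))) = r"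
        using \<zeta>_invert[OF nz] by (simp add: move_def add.assoc add.left_commute[of b])
    qed
    show "\<forall>r\<in>UNIV - {p}. move p (case r of (x, y) \<Rightarrow> move (0, 0) (x + a, y + b + (\<theta> a)\<^sup>2 * (x + a))) = r"
    proof
      fix r :: "'k \<times> 'k" assume "r \<in> UNIV - {p}"
      then obtain x y where [simp]: "r = (x, y)" and ne: "(x, y) \<noteq> p" by (cases r) auto
      define u v where "u = x + a" and "v = y + b + (\<theta> a)\<^sup>2 * (x + a)"
      have "\<zeta> u v \<noteq> 0" using ne by (auto simp: u_def v_def)
      moreover have "x = u + a" "y = v + b + (\<theta> a)\<^sup>2 * u"
        by (simp_all add: u_def v_def add.commute add.left_commute)
      ultimately show "move p (case r of (x, y) \<Rightarrow> move (0, 0) (x + a, y + b + (\<theta> a)\<^sup>2 * (x + a))) = r"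
        using \<zeta>_invert[of u v] by (simp add: move_def u_def[symmetric] v_def[symmetric])
    qed
    show "move p ` (UNIV - {(0, 0)}) \<subseteq> UNIV - {p}"
      by (auto simp: move_def add.assoc)
    show "(\<lambda>(x, y). move (0, 0) (x + a, y + b + (\<theta> a)\<^sup>2 * (x + a))) ` (UNIV - {p}) \<subseteq> UNIV - {(0, 0)}"
      by (auto simp: move_def)
  qed
qed

lemma section_move:
  "section_of A B C D E - {(a, b)} =
    move (a, b) ` (section_of D (C + D * a) (B + C * (\<theta> a)\<^sup>2 + D * (b + a * (\<theta> a)\<^sup>2) + E * \<theta> a)
      (\<Phi> A B C D E (a, b)) E - {(0, 0)})"
    (is "?L = _ ` ?R")
proof -
  have im: "move (a, b) ` (UNIV - {(0, 0)}) = UNIV - {(a, b)}"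
    using bij_move by (auto simp: bij_betw_def)
  have iff: "\<Phi> A B C D E (move (a, b) p) = 0 \<longleftrightarrow> p \<in> ?R" if "p \<noteq> (0, 0)" for p
  proof -
    have "p \<in> ?R \<longleftrightarrow> \<Phi> A B C D E (move (a, b) p) * \<zeta> (fst p) (snd p) = 0"
      using that by (simp add: section_of_def \<Phi>_move[OF that])
    thus ?thesis using that by (cases p) auto
  qed
  show ?thesis
  proof (intro equalityI subsetI)
    fix r assume r: "r \<in> ?L"
    then obtain p where "p \<noteq> (0, 0)" "r = move (a, b) p" using im by blast
    thus "r \<in> move (a, b) ` ?R" using iff r by (auto simp: section_of_def)
  next
    fix r assume "r \<in> move (a, b) ` ?R"
    then obtain p where p: "p \<in> ?R" "p \<noteq> (0, 0)" "r = move (a, b) p" by blast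
    have "r \<in> UNIV - {(a, b)}" unfolding im[symmetric] p(3) using p(2) by blast
    thus "r \<in> ?L" using iff[OF p(2)] p by (simp add: section_of_def)
  qed
qed

lemma card_section_move:
  assumes "(a, b) \<in> section_of A B C D E" "D \<noteq> 0"
  shows "card (section_of A B C D E) =
    Suc (card (section_of D (C + D * a) (B + C * (\<theta> a)\<^sup>2 + D * (b + a * (\<theta> a)\<^sup>2) + E * \<theta> a) 0 E))"
    (is "_ = Suc (card ?R)")
proof -
  have [simp]: "\<Phi> A B C D E (a, b) = 0" using assms by (simp add: section_of_def)
  \<comment> \<open>At the origin the moved equation has the value \<open>D\<close>, so removing the
    origin loses no point; the \<open>Suc\<close> counts \<open>(a, b)\<close>.\<close>
  have notin: "(0, 0) \<notin> ?R" using assms by (simp add: section_of_def \<Phi>_def)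
  have "card (section_of A B C D E) = Suc (card (section_of A B C D E - {(a, b)}))"
    by (rule card.remove[OF finite assms(1)])
  also have "section_of A B C D E - {(a, b)} = move (a, b) ` ?R"
    using section_move[of A B C D E a b] notin by simp
  also have "card \<dots> = card ?R"
    by (rule card_image, rule inj_on_subset[OF bij_betw_imp_inj_on[OF bij_move]]) (use notin in auto)
  finally show ?thesis .
qed

lemma additive_inj_imp_surj:
  fixes f :: "'k \<Rightarrow> 'k"
  assumes "\<And>x y. f (x + y) = f x + f y" "\<And>x. f x = 0 \<Longrightarrow> x = 0"
  shows "\<exists>x. f x = y"
proof (rule inj_imp_surj, rule injI)
  fix x y :: 'k assume "f x = f y"
  hence "f (x + y) = 0" by (simp add: assms(1))
  thus "x = y" using assms(2)[of "x + y"] by simp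
qed

section \<open>Sizes of hyperplane sections\<close>

text \<open>
  On a line \<open>x = a\<close> the equation is additive in \<open>y\<close>, up to a constant, and for a suitable \<open>a\<close> its
  homogeneous part has no nonzero root.
\<close>

lemma section_nonempty:
  assumes "D \<noteq> 0"
  obtains a b where "(a, b) \<in> section_of A B C D E"
proof -
  \<comment> \<open>There are only \<open>CARD('k) - 1\<close> nonzero \<open>y\<close>, so some
    \<open>c\<close> keeps \<open>c * y + D * (\<theta> y)\<^sup>2 + E * \<theta> y\<close> nonzero
    for all of them.\<close>
  have "(\<lambda>y. (D * (\<theta> y)\<^sup>2 + E * \<theta> y) / y) ` (UNIV - {0}) \<noteq> UNIV" (is "?I \<noteq> _")
  proof
    assume "?I = UNIV"
    moreover have "card ?I \<le> card (UNIV - {0 :: 'k})"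
      by (rule card_image_le) simp
    moreover have "card (UNIV - {0 :: 'k}) < CARD('k)"
      by (rule psubset_card_mono) auto
    ultimately show False by (simp only:)
  qed
  then obtain c where c: "c \<notin> ?I" by blast
  define a where "a = (c + C) / D"
  have a: "C + D * a = c" using assms by (simp add: a_def add.commute)
  define f where "f y = c * y + D * (\<theta> y)\<^sup>2 + E * \<theta> y" for y
  have "\<exists>y. f y = A + B * a + D * (a * \<theta> a)\<^sup>2 + E * (a * \<theta> a)"
  proof (rule additive_inj_imp_surj)
    show "f (x + y) = f x + f y" for x y by (simp add: f_def \<theta>_add sq_add algebra_simps)
    show "x = 0" if "f x = 0" for x
    proof (rule ccontr)
      assume "x \<noteq> 0"
      have "c * x = D * (\<theta> x)\<^sup>2 + E * \<theta> x" using that by (simp add: f_def add.assoc)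
      hence "c = (D * (\<theta> x)\<^sup>2 + E * \<theta> x) / x" using \<open>x \<noteq> 0\<close> by (metis nonzero_mult_div_cancel_right)
      thus False using c \<open>x \<noteq> 0\<close> by blast
    qed
  qed
  then obtain b where b: "f b = A + B * a + D * (a * \<theta> a)\<^sup>2 + E * (a * \<theta> a)" by blast
  have "\<Phi> A B C D E (a, b) = A + B * a + D * (a * \<theta> a)\<^sup>2 + E * (a * \<theta> a) + ((C + D * a) * b + D * (\<theta> b)\<^sup>2 + E * \<theta> b)"
    by (simp add: \<Phi>_def \<zeta>_def \<rho>_def sq_add algebra_simps)
  also have "\<dots> = 0" unfolding a b[symmetric] by (simp add: f_def)
  finally show ?thesis using that by (simp add: section_of_def)
qed

section \<open>The trace character and a character sum\<close>

definition J :: "'k set" where "J = range (\<lambda>y. \<theta> y + y)"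

lemma J_add: "s \<in> J \<Longrightarrow> t \<in> J \<Longrightarrow> s + t \<in> J"
proof -
  assume "s \<in> J" "t \<in> J"
  then obtain x y where "s = \<theta> x + x" "t = \<theta> y + y" by (auto simp: J_def)
  hence "s + t = \<theta> (x + y) + (x + y)" by (simp add: \<theta>_add algebra_simps)
  thus ?thesis by (auto simp: J_def)
qed

lemma J_add_iff: "s \<in> J \<Longrightarrow> s + t \<in> J \<longleftrightarrow> t \<in> J"
  using J_add[of s t] J_add[of s "s + t"] by auto

text \<open>A nonempty fibre is a coset of the kernel of \<open>\<theta> w + w\<close>, which is
  \<open>{0, 1}\<close>.\<close>

lemma card_fiber_J: "card {w. \<theta> w + w = t} = (if t \<in> J then 2 else 0)"
proof (cases "t \<in> J")
  case True
  then obtain y where t: "t = \<theta> y + y" by (auto simp: J_def)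
  have "{w. \<theta> w + w = t} = {y, y + 1}"
  proof (intro equalityI subsetI)
    fix w assume "w \<in> {w. \<theta> w + w = t}"
    hence "\<theta> w + w + (\<theta> y + y) = 0" by (simp add: t)
    hence "\<theta> (w + y) + (w + y) = 0" by (simp add: \<theta>_add ac_simps)
    hence "w + y = 0 \<or> w + y = 1" using \<theta>_fixed[of "w + y"] by simp
    thus "w \<in> {y, y + 1}" by (auto simp flip: add.assoc) (metis add.commute add_self_left)
  qed (auto simp: t \<theta>_add ac_simps)
  thus ?thesis using True by (simp add: card_insert_if)
qed (auto simp: J_def)

lemma card_J: "2 * card J = CARD('k)"
proof -
  have "CARD('k) = (\<Sum>t\<in>J. card {w. \<theta> w + w = t})"
    using sum.image_gen[of "UNIV :: 'k set" "\<lambda>_. 1 :: nat" "\<lambda>y. \<theta> y + y"] by (simp add: J_def)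
  also have "\<dots> = (\<Sum>t\<in>J. 2)" by (rule sum.cong) (auto simp: card_fiber_J)
  finally show ?thesis by simp
qed

lemma card_compl_J: "card (- J) = card J"
  using card_J by (simp add: Compl_eq_Diff_UNIV card_Diff_subset)

text \<open>\<open>J\<close> has index 2, so its translate by \<open>s\<close> fills the whole
  complement.\<close>

lemma add_notin_J: assumes "s \<notin> J" "t \<notin> J" shows "s + t \<in> J"
proof -
  have "(\<lambda>x. x + s) ` J \<subseteq> - J" using assms(1) J_add_iff by auto
  moreover have "card ((\<lambda>x. x + s) ` J) = card (- J)"
    by (simp add: card_compl_J card_image)
  ultimately have "(\<lambda>x. x + s) ` J = - J" by (intro card_subset_eq) auto
  then obtain x where "x \<in> J" "t = x + s" using assms(2) by blast
  thus ?thesis by (simp add: add.left_commute)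
qed

text \<open>As \<open>\<theta>\<close> generates the Galois group, \<open>J\<close> is the kernel of
  the absolute trace by the additive form of Hilbert 90, and this is the trace character.\<close>

definition \<psi> :: "'k \<Rightarrow> int" where "\<psi> t = (if t \<in> J then 1 else - 1)"

lemma \<psi>_add: "\<psi> (s + t) = \<psi> s * \<psi> t"
  using J_add_iff[of s t] J_add_iff[of t s] add_notin_J[of s t] by (auto simp: \<psi>_def add.commute)

lemma \<psi>_\<theta>: "\<psi> (\<theta> t) = \<psi> t"
  using J_add_iff[of "\<theta> t + t" t] by (auto simp: \<psi>_def J_def ac_simps)

lemma \<psi>_sq: "\<psi> (t\<^sup>2) = \<psi> t"
  using \<psi>_\<theta>[of "t\<^sup>2"] \<psi>_\<theta>[of "\<theta> (t\<^sup>2)"] by (simp add: \<theta>_sq \<theta>_\<theta>_sq)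

lemma sum_\<psi>: "(\<Sum>x\<in>UNIV. \<psi> x) = 0"
proof -
  have "(\<Sum>x\<in>UNIV. \<psi> x) = (\<Sum>x\<in>J. \<psi> x) + (\<Sum>x\<in>-J. \<psi> x)"
    by (metis Compl_eq_Diff_UNIV finite sum.subset_diff subset_UNIV add.commute)
  also have "\<dots> = 0" by (simp add: \<psi>_def card_compl_J)
  finally show ?thesis .
qed

lemma sum_\<psi>_mult: "(\<Sum>x\<in>UNIV. \<psi> (\<mu> * x)) = (if \<mu> = 0 then int CARD('k) else 0)"
proof (cases "\<mu> = 0")
  case True
  have "0 \<in> J" by (auto simp: J_def intro: range_eqI[of _ _ 0])
  thus ?thesis using True by (simp add: \<psi>_def)
next
  case False
  have "bij_betw ((*) \<mu>) UNIV UNIV"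
    by (rule bij_betw_byWitness[where f' = "\<lambda>y. y / \<mu>"]) (use False in auto)
  from sum.reindex_bij_betw[OF this, of \<psi>] show ?thesis using False by (simp add: sum_\<psi>)
qed

text \<open>
  The Gold function \<open>x\<^sup>n\<^sup>+\<^sup>1\<close> is a quadratic form over the prime field whose polar form, composed with
  the character, has a radical of size at most 2; squaring the sum therefore leaves at most two
  nonvanishing inner sums.
\<close>

lemma character_sum_bound:
  assumes "c \<noteq> 0"
  shows "\<bar>\<Sum>x\<in>UNIV. \<psi> (c * (A + B * x + x * \<theta> x))\<bar> \<le> 2 * int n"
proof -
  define g where "g x = c * (A + B * x + x * \<theta> x)" for x
  \<comment> \<open>This coefficient arises by moving \<open>\<theta>\<close> off \<open>x\<close>:
    \<open>\<psi> (c * h * \<theta> x) = \<psi> ((\<theta> (c * h))\<^sup>2 * x)\<close>, because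
    \<open>\<psi>\<close> is invariant under \<open>\<theta>\<close> and squaring.\<close>
  define \<mu> where "\<mu> h = c * \<theta> h + (\<theta> (c * h))\<^sup>2" for h
  let ?S = "\<Sum>x\<in>UNIV. \<psi> (g x)"
  have g: "\<psi> (g x) * \<psi> (g (x + h)) = \<psi> (c * (B * h + h * \<theta> h)) * \<psi> (\<mu> h * x)" for x h
  proof -
    have "\<psi> (g x) * \<psi> (g (x + h)) = \<psi> (g x + g (x + h))" by (simp add: \<psi>_add)
    also have "g x + g (x + h) = c * (B * h + h * \<theta> h) + (c * \<theta> h * x + (c * h) * \<theta> x)"
      by (simp add: g_def \<theta>_add algebra_simps)
    also have "\<psi> \<dots> = \<psi> (c * (B * h + h * \<theta> h)) * (\<psi> (c * \<theta> h * x) * \<psi> ((c * h) * \<theta> x))"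
      by (simp only: \<psi>_add)
    also have "\<psi> ((c * h) * \<theta> x) = \<psi> ((\<theta> (c * h * \<theta> x))\<^sup>2)" by (simp only: \<psi>_sq \<psi>_\<theta>)
    also have "(\<theta> (c * h * \<theta> x))\<^sup>2 = (\<theta> (c * h))\<^sup>2 * x"
      by (simp add: \<theta>_mult power_mult_distrib \<theta>_\<theta>_sq)
    also have "\<psi> (c * \<theta> h * x) * \<psi> ((\<theta> (c * h))\<^sup>2 * x) = \<psi> (\<mu> h * x)"
      by (simp add: \<mu>_def distrib_right \<psi>_add)
    finally show ?thesis .
  qed
  have shift: "?S = (\<Sum>h\<in>UNIV. \<psi> (g (x + h)))" for x
    by (rule sum.reindex_bij_betw[symmetric], rule bij_betw_byWitness[where f' = "\<lambda>y. x + y"]) auto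
  have "?S * ?S = (\<Sum>x\<in>UNIV. \<psi> (g x) * ?S)"
    by (rule sum_distrib_right)
  also have "\<dots> = (\<Sum>x\<in>UNIV. \<Sum>h\<in>UNIV. \<psi> (g x) * \<psi> (g (x + h)))"
  proof (rule sum.cong[OF refl])
    show "\<psi> (g x) * ?S = (\<Sum>h\<in>UNIV. \<psi> (g x) * \<psi> (g (x + h)))" for x
      by (subst shift[of x]) (rule sum_distrib_left)
  qed
  also have "\<dots> = (\<Sum>h\<in>UNIV. \<Sum>x\<in>UNIV. \<psi> (c * (B * h + h * \<theta> h)) * \<psi> (\<mu> h * x))"
    unfolding g by (rule sum.swap)
  also have "\<dots> = (\<Sum>h\<in>UNIV. \<psi> (c * (B * h + h * \<theta> h)) * (if \<mu> h = 0 then int CARD('k) else 0))"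
    by (simp flip: sum_distrib_left add: sum_\<psi>_mult)
  also have "\<dots> \<le> (\<Sum>h\<in>UNIV. if \<mu> h = 0 then int CARD('k) else 0)"
    by (rule sum_mono) (auto simp: \<psi>_def)
  also have "\<dots> = int CARD('k) * int (card {h. \<mu> h = 0})"
    by (simp add: sum.If_cases)
  also have "card {h. \<mu> h = 0} \<le> 2"
  proof (cases "\<exists>h. h \<noteq> 0 \<and> \<mu> h = 0")
    case True
    then obtain h where h: "h \<noteq> 0" "\<mu> h = 0" by blast
    have *: "(\<theta> c)\<^sup>2 * \<theta> h = c" if "h \<noteq> 0" "\<mu> h = 0" for h
    proof -
      have "\<theta> h * ((\<theta> c)\<^sup>2 * \<theta> h) = \<theta> h * c"
        using that(2) by (auto simp: \<mu>_def \<theta>_mult power2_eq_square ac_simps)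
      thus ?thesis using that(1) by simp
    qed
    have "{h. \<mu> h = 0} \<subseteq> {0, h}"
    proof clarify
      fix h' assume "\<mu> h' = 0" "h' \<noteq> 0" "h' \<notin> {}"
      hence "(\<theta> c)\<^sup>2 * \<theta> h' = (\<theta> c)\<^sup>2 * \<theta> h" using *[of h] *[of h'] h by simp
      thus "h' = h" using assms by simp
    qed
    from card_mono[OF _ this] show ?thesis using h by simp
  next
    case False
    hence "{h. \<mu> h = 0} \<subseteq> {0}" by auto
    from card_mono[OF _ this] show ?thesis by simp
  qed
  finally have "?S * ?S \<le> int CARD('k) * 2" by (simp add: mult_left_mono)
  hence "?S\<^sup>2 \<le> (2 * int n)\<^sup>2" by (simp add: card_eq power2_eq_square)
  thus ?thesis unfolding g_def using abs_le_square_iff[of _ "2 * int n"] by simp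
qed

text \<open>Substituting \<open>y = \<kappa> * w\<close> turns \<open>\<theta> y + C * y\<close>
  into \<open>\<theta> \<kappa> * (\<theta> w + w)\<close>.\<close>

lemma card_fiber:
  assumes "\<theta> \<kappa> = C * \<kappa>" "\<kappa> \<noteq> 0"
  shows "int (card {y. \<theta> y + C * y = t}) = 1 + \<psi> (t / \<theta> \<kappa>)"
proof -
  have "{y. \<theta> y + C * y = t} = (\<lambda>w. \<kappa> * w) ` {w. \<theta> w + w = t / \<theta> \<kappa>}"
  proof (intro equalityI subsetI)
    fix y assume y: "y \<in> {y. \<theta> y + C * y = t}"
    have "\<theta> \<kappa> \<noteq> 0" using assms(2) by simp
    hence "C \<noteq> 0" using assms(1) by auto
    hence "\<theta> (y / \<kappa>) + y / \<kappa> = (\<theta> y + C * y) / \<theta> \<kappa>"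
      using assms by (simp add: \<theta>_divide add_divide_distrib)
    hence "y / \<kappa> \<in> {w. \<theta> w + w = t / \<theta> \<kappa>}" using y by simp
    thus "y \<in> (\<lambda>w. \<kappa> * w) ` {w. \<theta> w + w = t / \<theta> \<kappa>}"
      using assms(2) by (intro image_eqI[of _ _ "y / \<kappa>"]) auto
  next
    fix y assume "y \<in> (\<lambda>w. \<kappa> * w) ` {w. \<theta> w + w = t / \<theta> \<kappa>}"
    then obtain w where w: "\<theta> w + w = t / \<theta> \<kappa>" "y = \<kappa> * w" by blast
    have "\<theta> y + C * y = \<theta> \<kappa> * (\<theta> w + w)" by (simp add: w(2) \<theta>_mult assms(1) algebra_simps)
    also have "\<dots> = t" using w assms(2) by simp
    finally show "y \<in> {y. \<theta> y + C * y = t}" by simp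
  qed
  moreover have "inj_on (\<lambda>w. \<kappa> * w) A" for A using assms(2) by (simp add: inj_on_def)
  ultimately show ?thesis by (simp add: card_image card_fiber_J \<psi>_def)
qed

text \<open>Count by columns. For \<open>C = 0\<close> each column contains one point; otherwise the
  total is \<open>CARD('k)\<close> plus the character sum.\<close>

lemma section_D0_lower_bound: "card (section_of A B C 0 1) + 2 * n \<ge> CARD('k)"
proof -
  have "section_of A B C 0 1 = (SIGMA x:UNIV. {y. \<theta> y + C * y = A + B * x + x * \<theta> x})"
  proof -
    have "\<Phi> A B C 0 1 (x, y) = 0 \<longleftrightarrow> \<theta> y + C * y = A + B * x + x * \<theta> x" for x y
    proof -
      have "\<Phi> A B C 0 1 (x, y) = \<theta> y + C * y + (A + B * x + x * \<theta> x)"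
        by (simp add: \<Phi>_def \<rho>_def ac_simps)
      thus ?thesis by (simp only: add_eq_0)
    qed
    thus ?thesis by (auto simp: section_of_def)
  qed
  hence N: "card (section_of A B C 0 1) = (\<Sum>x\<in>UNIV. card {y. \<theta> y + C * y = A + B * x + x * \<theta> x})"
    by simp
  show ?thesis
  proof (cases "C = 0")
    case True
    have "card {y. \<theta> y = t} = 1" for t
    proof -
      obtain y where "\<theta> y = t" using \<theta>_surj by blast
      hence "{y. \<theta> y = t} = {y}" by auto
      thus ?thesis by simp
    qed
    thus ?thesis unfolding N using True by simp
  next
    case False
    then obtain \<kappa> where \<kappa>: "\<kappa> \<noteq> 0" "\<theta> \<kappa> = C * \<kappa>" using \<theta>_ratio_surj by blast
    have "int (card (section_of A B C 0 1)) = (\<Sum>x\<in>UNIV. 1 + \<psi> ((1 / \<theta> \<kappa>) * (A + B * x + x * \<theta> x)))"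
      unfolding N by (simp add: card_fiber[OF \<kappa>(2,1)] del: add_divide_distrib)
    also have "\<dots> = int CARD('k) + (\<Sum>x\<in>UNIV. \<psi> ((1 / \<theta> \<kappa>) * (A + B * x + x * \<theta> x)))"
      by (simp add: sum.distrib)
    finally show ?thesis
      using character_sum_bound[of "1 / \<theta> \<kappa>" A B] \<kappa> False by simp
  qed
qed

text \<open>After scaling to \<open>E = 1\<close>, a point of the section is moved to infinity,
  where the bound for \<open>D = 0\<close> applies. That point is counted in addition, so the
  inequality is strict.\<close>

lemma section_lower_bound:
  assumes "D \<noteq> 0" "E \<noteq> 0"
  shows "card (section_of A B C D E) + 2 * n > CARD('k)"
proof -
  have scale: "section_of (A / E) (B / E) (C / E) (D / E) 1 = section_of A B C D E"
  proof -
    have "\<Phi> (A / E) (B / E) (C / E) (D / E) 1 p = \<Phi> A B C D E p / E" for p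
      using assms(2) by (cases p) (simp add: \<Phi>_def add_divide_distrib)
    thus ?thesis using assms(2) by (simp add: section_of_def)
  qed
  obtain a b where "(a, b) \<in> section_of (A / E) (B / E) (C / E) (D / E) 1"
    by (rule section_nonempty[of "D / E"]) (use assms in auto)
  from card_section_move[OF this] show ?thesis
    unfolding scale using assms section_D0_lower_bound
    by (smt (verit, best) Suc_le_eq add_Suc divide_eq_0_iff le_imp_less_Suc)
qed

text \<open>This is a polynomial equation because \<open>\<theta> y = y ^ n\<close>. Since
  \<open>n \<ge> 2\<close>, the coefficient \<open>E\<close> sits apart from \<open>c\<close>,
  \<open>d\<close> and \<open>F\<close>, so the polynomial is nonzero.\<close>

lemma card_additive_roots:
  assumes "E \<noteq> 0"
  shows "card {y. c + d * y + E * \<theta> y + F * (\<theta> y)\<^sup>2 = 0} \<le> (if F = 0 then n else 2 * n)"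
proof -
  define p where "p = [:c, d:] + monom E n + monom F (2 * n)"
  have n: "n \<ge> 2" by (rule n_ge_2)
  have "coeff [:c, d:] n = 0" using n by (intro coeff_eq_0) simp
  hence "coeff p n = E" using n by (simp add: p_def)
  hence "p \<noteq> 0" using assms by auto
  have "c + d * y + E * \<theta> y + F * (\<theta> y)\<^sup>2 = poly p y" for y
    by (simp add: p_def poly_monom \<theta>_def algebra_simps power_mult[symmetric])
  hence "card {y. c + d * y + E * \<theta> y + F * (\<theta> y)\<^sup>2 = 0} \<le> degree p"
    using card_poly_roots_bound[OF \<open>p \<noteq> 0\<close>] by simp
  also have "degree p \<le> (if F = 0 then n else 2 * n)"
    unfolding p_def using n degree_monom_le[of E n] degree_monom_le[of F "2 * n"]
    by (auto intro!: degree_add_le simp: degree_pCons_eq_if intro: order_trans)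
  finally show ?thesis .
qed

section \<open>Circles, and the lines they become when a point is moved to infinity\<close>

lemma vertical_line: "c \<noteq> 0 \<Longrightarrow> section_of 1 c 0 0 0 = {1 / c} \<times> UNIV"
  by (auto simp: section_of_def \<Phi>_def field_simps)

lemma card_line:
  assumes "(c, d) \<noteq> (0, 0)"
  shows "card (section_of 1 c d 0 0) = CARD('k)"
proof (cases "d = 0")
  case True
  hence "c \<noteq> 0" using assms by simp
  thus ?thesis using True by (simp add: vertical_line card_cartesian_product)
next
  case False
  have iff: "(x, y) \<in> section_of 1 c d 0 0 \<longleftrightarrow> y = (1 + c * x) / d" for x y
  proof -
    have "(x, y) \<in> section_of 1 c d 0 0 \<longleftrightarrow> 1 + c * x + d * y = 0" by (simp add: section_of_def \<Phi>_def)
    also have "\<dots> \<longleftrightarrow> y = (1 + c * x) / d"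
      unfolding add_eq_0 nonzero_eq_divide_eq[OF False] mult.commute[of y] by (rule eq_commute)
    finally show ?thesis .
  qed
  have "section_of 1 c d 0 0 = (\<lambda>x. (x, (1 + c * x) / d)) ` UNIV"
  proof (rule set_eqI)
    show "p \<in> section_of 1 c d 0 0 \<longleftrightarrow> p \<in> (\<lambda>x. (x, (1 + c * x) / d)) ` UNIV" for p
      by (cases p) (simp add: iff image_iff)
  qed
  thus ?thesis by (simp add: card_image inj_on_def)
qed

text \<open>By Cramer's rule two common points make the determinant vanish; the equal constant terms
  1 then force equal coefficients.\<close>

lemma card_lines_Int:
  assumes "(c, d) \<noteq> (c', d')"
  shows "card (section_of 1 c d 0 0 \<inter> section_of 1 c' d' 0 0) \<le> 1"
proof -
  have eq: "(x, y) = (x', y')"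
    if "1 + c * x + d * y = 0" "1 + c' * x + d' * y = 0" "1 + c * x' + d * y' = 0" "1 + c' * x' + d' * y' = 0"
    for x y x' y'
  proof (rule ccontr)
    assume ne: "(x, y) \<noteq> (x', y')"
    have "(c * d' - c' * d) * (x - x') = d' * ((1 + c * x + d * y) - (1 + c * x' + d * y'))
        - d * ((1 + c' * x + d' * y) - (1 + c' * x' + d' * y'))"
      "(c * d' - c' * d) * (y - y') = c * ((1 + c' * x + d' * y) - (1 + c' * x' + d' * y'))
        - c' * ((1 + c * x + d * y) - (1 + c * x' + d * y'))"
      by (simp_all add: algebra_simps)
    hence det: "c * d' - c' * d = 0" using ne unfolding that by auto
    have "d' - d = d' * (1 + c * x + d * y) - d * (1 + c' * x + d' * y) - (c * d' - c' * d) * x"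
      "c' - c = c' * (1 + c * x + d * y) - c * (1 + c' * x + d' * y) + (c * d' - c' * d) * y"
      by (simp_all add: algebra_simps)
    hence "d' - d = 0" "c' - c = 0" unfolding that det by simp_all
    thus False using assms by simp
  qed
  have "\<forall>p\<in>section_of 1 c d 0 0 \<inter> section_of 1 c' d' 0 0. \<forall>r\<in>section_of 1 c d 0 0 \<inter> section_of 1 c' d' 0 0. p = r"
  proof (intro ballI)
    fix p r assume *: "p \<in> section_of 1 c d 0 0 \<inter> section_of 1 c' d' 0 0" "r \<in> section_of 1 c d 0 0 \<inter> section_of 1 c' d' 0 0"
    show "p = r" using eq[of "fst p" "snd p" "fst r" "snd r"] *
      by (simp add: section_of_def \<Phi>_def split_beta)
  qed
  thus ?thesis by (simp add: card_le_Suc0_iff_eq)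
qed

text \<open>The circle cut out by the hyperplane perpendicular to \<open>(1, m, 1, 0, \<surd>m)\<close>.\<close>

abbreviation circle :: "'k \<Rightarrow> ('k \<times> 'k) set" where
  "circle m \<equiv> section_of 0 1 m 1 0"

text \<open>
  Every circle has a point such that moving it to infinity turns the circle into a vertical
  line; there the equation of a section has degree at most \<open>2n\<close>.
\<close>

lemma circle_corner:
  obtains a b where "(a, b) \<in> circle m" "1 + m * (\<theta> a)\<^sup>2 + (b + a * (\<theta> a)\<^sup>2) = 0" "a \<noteq> m"
proof -
  have "\<zeta> m 1 \<noteq> 0" by simp
  then obtain k where k: "k \<noteq> 0" "(\<theta> k)\<^sup>2 * k\<^sup>2 = \<zeta> m 1" using \<theta>_mult_self_surj by blast
  \<comment> \<open>The choice of \<open>b\<close> is the second condition solved for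
    \<open>b\<close>; the first then reduces to the equation for \<open>k\<close>.\<close>
  define a where "a = m + k"
  define b where "b = 1 + k * (\<theta> a)\<^sup>2"
  have "\<theta> b = 1 + \<theta> k * a"
    by (simp add: b_def \<theta>_add \<theta>_mult \<theta>_sq \<theta>_\<theta>_sq)
  hence "\<Phi> 0 1 m 1 0 (a, b) = a + (m + a) * b + a\<^sup>2 * (\<theta> a)\<^sup>2 + (1 + (\<theta> k)\<^sup>2 * a\<^sup>2)"
    by (simp add: \<Phi>_def \<zeta>_def \<rho>_def sq_add power_mult_distrib algebra_simps)
  also have "m + a = k" by (simp add: a_def)
  also have "a + k * b + a\<^sup>2 * (\<theta> a)\<^sup>2 + (1 + (\<theta> k)\<^sup>2 * a\<^sup>2) = m + 1 + m\<^sup>2 * (\<theta> m)\<^sup>2 + (\<theta> k)\<^sup>2 * k\<^sup>2"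
    by (simp add: b_def a_def \<theta>_add sq_add algebra_simps) (simp add: power2_eq_square algebra_simps)
  also have "\<dots> = 0"
    unfolding k by (simp add: \<zeta>_def \<rho>_def sq_add power_mult_distrib ac_simps)
  finally have "(a, b) \<in> circle m" by (simp add: section_of_def)
  moreover have "1 + m * (\<theta> a)\<^sup>2 + (b + a * (\<theta> a)\<^sup>2) = 1 + (m + a) * (\<theta> a)\<^sup>2 + b"
    by (simp add: algebra_simps)
  hence "1 + m * (\<theta> a)\<^sup>2 + (b + a * (\<theta> a)\<^sup>2) = 0" by (simp add: a_def b_def)
  moreover have "a \<noteq> m" using k by (simp add: a_def)
  ultimately show ?thesis by (rule that)
qed

lemma card_circle: "card (circle m) = Suc CARD('k)"
proof -
  obtain a b where *: "(a, b) \<in> circle m" "1 + m * (\<theta> a)\<^sup>2 + (b + a * (\<theta> a)\<^sup>2) = 0" "a \<noteq> m"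
    by (rule circle_corner)
  have "card (circle m) = Suc (card (section_of 1 (m + 1 * a) (1 + m * (\<theta> a)\<^sup>2 + 1 * (b + a * (\<theta> a)\<^sup>2) + 0 * \<theta> a) 0 0))"
    using *(1) by (rule card_section_move) simp
  also have "card (section_of 1 (m + 1 * a) (1 + m * (\<theta> a)\<^sup>2 + 1 * (b + a * (\<theta> a)\<^sup>2) + 0 * \<theta> a) 0 0) = CARD('k)"
    by (rule card_line) (use *(3) in simp)
  finally show ?thesis .
qed

lemma move_image_Int_subset:
  "move p ` (S - {(0, 0)}) \<inter> move p ` (T - {(0, 0)}) \<subseteq> move p ` (S \<inter> T - {(0, 0)})"
proof
  fix r assume "r \<in> move p ` (S - {(0, 0)}) \<inter> move p ` (T - {(0, 0)})"
  then obtain s t where st: "s \<in> S - {(0, 0)}" "t \<in> T - {(0, 0)}" "r = move p s" "r = move p t" by blast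
  moreover have "inj_on (move p) (UNIV - {(0, 0)})" using bij_move by (rule bij_betw_imp_inj_on)
  ultimately have "s = t" by (metis DiffD2 DiffI UNIV_I inj_onD)
  thus "r \<in> move p ` (S \<inter> T - {(0, 0)})" using st by blast
qed

lemma card_circle_Int_section:
  assumes "E \<noteq> 0"
  shows "card (section_of A B C D E \<inter> circle m) \<le> 2 * n"
proof -
  obtain a b where *: "(a, b) \<in> circle m" "1 + m * (\<theta> a)\<^sup>2 + (b + a * (\<theta> a)\<^sup>2) = 0" "a \<noteq> m"
    by (rule circle_corner)
  define A' where "A' = \<Phi> A B C D E (a, b)"
  define B' where "B' = C + D * a"
  define C' where "C' = B + C * (\<theta> a)\<^sup>2 + D * (b + a * (\<theta> a)\<^sup>2) + E * \<theta> a"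
  define x where "x = 1 / (m + a)"
  let ?X = "section_of A B C D E \<inter> circle m"
  let ?Y = "{y. (D + B' * x + A' * (x * \<theta> x)\<^sup>2 + E * (x * \<theta> x)) + (C' + A' * x) * y + E * \<theta> y + A' * (\<theta> y)\<^sup>2 = 0}"
  have "m + a \<noteq> 0" using *(3) by auto
  have circle: "circle m - {(a, b)} = move (a, b) ` (section_of 1 (m + a) 0 0 0 - {(0, 0)})"
    using section_move[of 0 1 m 1 0 a b] *(1,2) by (simp add: section_of_def)
  have line: "section_of 1 (m + a) 0 0 0 = {x} \<times> UNIV"
    unfolding x_def by (rule vertical_line[OF \<open>m + a \<noteq> 0\<close>])
  have "?X - {(a, b)} = (section_of A B C D E - {(a, b)}) \<inter> (circle m - {(a, b)})" by blast
  also have "\<dots> \<subseteq> move (a, b) ` (section_of D B' C' A' E \<inter> ({x} \<times> UNIV) - {(0, 0)})"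
    unfolding circle section_move[of A B C D E a b] line A'_def[symmetric] B'_def[symmetric] C'_def[symmetric]
    by (rule move_image_Int_subset)
  also have "section_of D B' C' A' E \<inter> ({x} \<times> UNIV) = Pair x ` ?Y"
  proof -
    have "\<Phi> D B' C' A' E (x, y) =
      (D + B' * x + A' * (x * \<theta> x)\<^sup>2 + E * (x * \<theta> x)) + (C' + A' * x) * y + E * \<theta> y + A' * (\<theta> y)\<^sup>2" for y
      by (simp add: \<Phi>_def \<zeta>_def \<rho>_def sq_add algebra_simps)
    thus ?thesis by (auto simp: section_of_def)
  qed
  finally have "?X - {(a, b)} \<subseteq> move (a, b) ` (Pair x ` ?Y)" by blast
  hence "card (?X - {(a, b)}) \<le> card (move (a, b) ` (Pair x ` ?Y))"
    by (rule card_mono[rotated]) simp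
  also have "\<dots> \<le> card ?Y" unfolding image_comp by (rule card_image_le) (rule finite)
  also have "\<dots> \<le> (if A' = 0 then n else 2 * n)" by (rule card_additive_roots[OF assms])
  finally have bound: "card (?X - {(a, b)}) \<le> (if A' = 0 then n else 2 * n)" .
  show ?thesis
  \<comment> \<open>If \<open>A' = 0\<close>, the corner itself lies on the section; the degree
    drops to \<open>n\<close>, and \<open>n + 1 \<le> 2 * n\<close> absorbs this point.\<close>
  proof (cases "A' = 0")
    case True
    have "card ?X \<le> Suc (card (?X - {(a, b)}))" using diff_card_le_card_Diff[of "{(a, b)}" ?X] by simp
    thus ?thesis using bound True n_ge_2 by simp
  next
    case False
    hence "(a, b) \<notin> ?X" by (simp add: A'_def section_of_def)
    thus ?thesis using bound False by simp
  qed
qed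

text \<open>With a common point moved to infinity, both sections become lines, which meet at most
  once more.\<close>

lemma card_circle_Int_section0:
  assumes "(A, B, C) \<noteq> (0, 1, m)"
  shows "card (section_of A B C 1 0 \<inter> circle m) \<le> 2"
proof (cases "section_of A B C 1 0 \<inter> circle m = {}")
  case False
  then obtain a b where ab: "(a, b) \<in> section_of A B C 1 0" "(a, b) \<in> circle m" by auto
  define c d where "c = C + a" and "d = B + C * (\<theta> a)\<^sup>2 + (b + a * (\<theta> a)\<^sup>2)"
  define c' d' where "c' = m + a" and "d' = 1 + m * (\<theta> a)\<^sup>2 + (b + a * (\<theta> a)\<^sup>2)"
  let ?X = "section_of A B C 1 0 \<inter> circle m"
  have ne: "(c, d) \<noteq> (c', d')"
  proof
    assume "(c, d) = (c', d')"
    hence CB: "C = m" "B = 1" by (auto simp: c_def c'_def d_def d'_def)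
    moreover have "A = 0" using ab unfolding CB by (simp add: section_of_def \<Phi>_def add.assoc)
    ultimately show False using assms by simp
  qed
  have 1: "section_of A B C 1 0 - {(a, b)} = move (a, b) ` (section_of 1 c d 0 0 - {(0, 0)})"
    using section_move[of A B C 1 0 a b] ab by (simp add: section_of_def c_def d_def)
  have 2: "circle m - {(a, b)} = move (a, b) ` (section_of 1 c' d' 0 0 - {(0, 0)})"
    using section_move[of 0 1 m 1 0 a b] ab by (simp add: section_of_def c'_def d'_def)
  have "?X - {(a, b)} = (section_of A B C 1 0 - {(a, b)}) \<inter> (circle m - {(a, b)})" by blast
  also have "\<dots> \<subseteq> move (a, b) ` (section_of 1 c d 0 0 \<inter> section_of 1 c' d' 0 0 - {(0, 0)})"
    unfolding 1 2 by (rule move_image_Int_subset)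
  finally have "?X - {(a, b)} \<subseteq> move (a, b) ` (section_of 1 c d 0 0 \<inter> section_of 1 c' d' 0 0)" by blast
  hence "card (?X - {(a, b)}) \<le> card (move (a, b) ` (section_of 1 c d 0 0 \<inter> section_of 1 c' d' 0 0))"
    by (rule card_mono[rotated]) simp
  also have "\<dots> \<le> card (section_of 1 c d 0 0 \<inter> section_of 1 c' d' 0 0)" by (rule card_image_le) simp
  also have "\<dots> \<le> 1" by (rule card_lines_Int[OF ne])
  finally have "card (?X - {(a, b)}) \<le> 1" .
  moreover have "card ?X \<le> Suc (card (?X - {(a, b)}))" using diff_card_le_card_Diff[of "{(a, b)}" ?X] by simp
  ultimately show ?thesis by simp
qed simp

text \<open>The excluded case \<open>(C, B) = (a, b)\<close> is the tangent hyperplane at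
  \<open>(a, b)\<close>, which meets the ovoid in that point only.\<close>

lemma card_section0:
  assumes "(a, b) \<in> section_of A B C 1 0" "(C, B) \<noteq> (a, b)"
  shows "card (section_of A B C 1 0) = Suc CARD('k)"
proof -
  have "card (section_of A B C 1 0) = Suc (card (section_of 1 (C + 1 * a) (B + C * (\<theta> a)\<^sup>2 + 1 * (b + a * (\<theta> a)\<^sup>2) + 0 * \<theta> a) 0 0))"
    using assms(1) by (rule card_section_move) simp
  also have "card (section_of 1 (C + 1 * a) (B + C * (\<theta> a)\<^sup>2 + 1 * (b + a * (\<theta> a)\<^sup>2) + 0 * \<theta> a) 0 0) = CARD('k)"
    by (rule card_line) (use assms(2) in \<open>auto simp: ac_simps\<close>)
  finally show ?thesis .
qed

text \<open>Adding the equations forces \<open>y = 0\<close>, where the circle becomes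
  \<open>x = (\<theta> x)\<^sup>2 * x\<^sup>2\<close>.\<close>

lemma circle_Int_circle:
  assumes "m \<noteq> m'" shows "circle m \<inter> circle m' = {(0, 0), (1, 0)}"
proof (intro equalityI subsetI)
  fix p assume p: "p \<in> circle m \<inter> circle m'"
  obtain x y where [simp]: "p = (x, y)" by (cases p)
  have 1: "x + m * y + \<zeta> x y = 0" "x + m' * y + \<zeta> x y = 0" using p by (simp_all add: section_of_def \<Phi>_def)
  have "(m + m') * y = (x + m * y + \<zeta> x y) + (x + m' * y + \<zeta> x y)" by (simp add: algebra_simps)
  hence "(m + m') * y = 0" unfolding 1 by simp
  hence y: "y = 0" using assms by simp
  have "1 * x = ((\<theta> x)\<^sup>2 * x) * x" using 1(1) y by (simp add: \<zeta>_def \<rho>_def power2_eq_square ac_simps)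
  hence "x = 0 \<or> (\<theta> x)\<^sup>2 * x = 1" by (metis mult_cancel_right)
  thus "p \<in> {(0, 0), (1, 0)}" using y \<theta>_sq_mult_eq_1[of x] by auto
qed (auto simp: section_of_def \<Phi>_def \<zeta>_def \<rho>_def)

lemma base_points_in_circle: "{(0, 0), (1, 0)} \<subseteq> circle m"
  by (auto simp: section_of_def \<Phi>_def \<zeta>_def \<rho>_def)

lemma card_circles:
  assumes "Ms \<noteq> {}"
  shows "card (\<Union>m\<in>Ms. circle m) = card Ms * (CARD('k) - 1) + 2"
proof -
  let ?P = "{(0, 0), (1, 0)} :: ('k \<times> 'k) set"
  have "(\<Union>m\<in>Ms. circle m) = ?P \<union> (\<Union>m\<in>Ms. circle m - ?P)"
    using assms base_points_in_circle by blast
  also have "card \<dots> = card ?P + card (\<Union>m\<in>Ms. circle m - ?P)"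
    by (rule card_Un_disjoint) auto
  also have "card (\<Union>m\<in>Ms. circle m - ?P) = (\<Sum>m\<in>Ms. card (circle m - ?P))"
    by (rule card_UN_disjoint) (use circle_Int_circle in \<open>simp_all, blast\<close>)
  also have "\<dots> = (\<Sum>m\<in>Ms. CARD('k) - 1)"
    by (rule sum.cong) (simp_all only: card_Diff_subset[OF finite base_points_in_circle] card_circle, simp)
  finally show ?thesis by simp
qed

section \<open>A maximal partial ovoid\<close>

text \<open>A triple \<open>(x, y, r)\<close> stands for the singular point
  \<open>(1, x, y, x * y + r\<^sup>2, r)\<close>. The point at infinity is not listed; it will
  become \<open>winf\<close>.\<close>

definition ovoid_part :: "'k set \<Rightarrow> ('k \<times> 'k \<times> 'k) set" where
  "ovoid_part Ms = (\<lambda>(x, y). (x, y, \<rho> x y)) ` (- (\<Union>m\<in>Ms. circle m))"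

text \<open>Since \<open>\<theta> (\<theta> m)\<close> is the square root of \<open>m\<close>, these
  are the points whose perpendicular hyperplanes cut out the circles.\<close>

definition replacement_part :: "'k set \<Rightarrow> ('k \<times> 'k \<times> 'k) set" where
  "replacement_part Ms = (\<lambda>m. (m, 1, \<theta> (\<theta> m))) ` Ms"

lemma \<rho>_sq_ne: "(\<rho> m 1)\<^sup>2 \<noteq> m"
proof
  assume "(\<rho> m 1)\<^sup>2 = m"
  hence "\<zeta> m 1 = 0" by (simp only: \<zeta>_def mult_1_right add_self)
  thus False by simp
qed

lemma card_parts:
  assumes "Ms \<noteq> {}"
  shows "card (ovoid_part Ms \<union> replacement_part Ms) + card Ms * (CARD('k) - 1) + 2 = CARD('k)\<^sup>2 + card Ms"
proof -
  have "ovoid_part Ms \<inter> replacement_part Ms = {}"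
  proof -
    have "\<rho> m 1 \<noteq> \<theta> (\<theta> m)" for m using \<rho>_sq_ne[of m] \<theta>_\<theta>_sq[of m] by metis
    thus ?thesis by (auto simp: ovoid_part_def replacement_part_def)
  qed
  hence "card (ovoid_part Ms \<union> replacement_part Ms) = card (ovoid_part Ms) + card (replacement_part Ms)"
    by (simp add: card_Un_disjoint)
  moreover have "card (replacement_part Ms) = card Ms"
    unfolding replacement_part_def by (rule card_image) (simp add: inj_on_def)
  moreover have "card (ovoid_part Ms) = card (- (\<Union>m\<in>Ms. circle m))"
    unfolding ovoid_part_def by (rule card_image) (auto simp: inj_on_def)
  moreover have "card (- U) + card U = CARD('k)\<^sup>2" for U :: "('k \<times> 'k) set"
    using card_Un_disjoint[of "- U" U] by (simp add: Compl_partition2 power2_eq_square)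
  ultimately show ?thesis using card_circles[OF assms] by (metis add.assoc add.commute)
qed

text \<open>The expression is the polar form of the two points. For two ovoid points a translation
  turns it into \<open>\<zeta> u v\<close>; for an ovoid point and a replacement point it is the
  circle equation.\<close>

lemma parts_pairwise:
  assumes "(x, y, r) \<in> ovoid_part Ms \<union> replacement_part Ms"
    and "(x', y', r') \<in> ovoid_part Ms \<union> replacement_part Ms"
    and "(x, y, r) \<noteq> (x', y', r')"
  shows "(x + x') * (y + y') + (r + r')\<^sup>2 \<noteq> 0"
proof -
  have oo: "(x + x') * (y + y') + (\<rho> x y + \<rho> x' y')\<^sup>2 \<noteq> 0" if "(x, y) \<noteq> (x', y')" for x y x' y'
  proof -
    define u v where "u = x + x'" and "v = y + y' + (\<theta> x')\<^sup>2 * u"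
    have x: "x = u + x'" by (simp add: u_def add.assoc)
    have y: "y = v + y' + (\<theta> x')\<^sup>2 * u" by (simp add: v_def ac_simps)
    have uv: "\<not> (u = 0 \<and> v = 0)" using that by (auto simp: u_def v_def)
    have "\<rho> x y = \<rho> u v + \<theta> x' * u + \<rho> x' y'" unfolding x y by (rule \<rho>_translate)
    hence "(x + x') * (y + y') + (\<rho> x y + \<rho> x' y')\<^sup>2 = u * (v + (\<theta> x')\<^sup>2 * u) + (\<rho> u v + \<theta> x' * u)\<^sup>2"
      by (simp add: x y ac_simps)
    also have "\<dots> = \<zeta> u v" by (simp add: \<zeta>_def sq_add power2_eq_square algebra_simps)
    finally show ?thesis using uv by simp
  qed
  have ov: "(x + m) * (y + 1) + (\<rho> x y + \<theta> (\<theta> m))\<^sup>2 \<noteq> 0" if "(x, y) \<notin> circle m" for x y m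
  proof -
    have "(x + m) * (y + 1) + (\<rho> x y + \<theta> (\<theta> m))\<^sup>2 = x + m * y + \<zeta> x y"
      by (simp add: sq_add \<theta>_\<theta>_sq \<zeta>_def algebra_simps)
    thus ?thesis using that by (simp add: section_of_def \<Phi>_def)
  qed
  have vv: "(\<theta> (\<theta> m) + \<theta> (\<theta> m'))\<^sup>2 \<noteq> 0" if "m \<noteq> m'" for m m'
    using that by (simp add: \<theta>_\<theta>_sq)
  show ?thesis
    using assms oo[of x y x' y'] ov[of x y x'] ov[of x' y' x] vv[of x x']
    by (auto simp: ovoid_part_def replacement_part_def add.commute)
qed

text \<open>The new point has six free coordinates, while the listed points have
  \<open>g = h = r\<close> and \<open>u = w = 0\<close>. The ovoid points perpendicular to the new
  point form the section with coefficients \<open>A\<close>, \<open>y'\<close>, \<open>x'\<close>,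
  1, \<open>E\<close>.\<close>

lemma parts_maximal:
  assumes Ms: "Ms \<noteq> {}" "card Ms < n"
  shows "\<exists>(x, y, r) \<in> ovoid_part Ms \<union> replacement_part Ms. (x' + x) * (y' + y) + (g + r) * (h + r) + u * w = 0"
proof (rule ccontr)
  assume contra: "\<not> ?thesis"
  define A where "A = x' * y' + g * h + u * w"
  define E where "E = g + h"
  have expand: "(x' + x) * (y' + y) + (g + r) * (h + r) + u * w = A + y' * x + x' * y + (x * y + r\<^sup>2) + E * r" for x y r
    by (simp add: A_def E_def power2_eq_square algebra_simps)
  have sub: "section_of A y' x' 1 E \<subseteq> (\<Union>m\<in>Ms. circle m)"
  proof (rule subsetI, rule ccontr)
    fix p assume p: "p \<in> section_of A y' x' 1 E" "p \<notin> (\<Union>m\<in>Ms. circle m)"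
    obtain x y where [simp]: "p = (x, y)" by (cases p)
    have "(x, y, \<rho> x y) \<in> ovoid_part Ms"
      unfolding ovoid_part_def by (rule image_eqI[of _ _ p]) (use p in simp_all)
    moreover have "(x' + x) * (y' + y) + (g + \<rho> x y) * (h + \<rho> x y) + u * w = 0"
      using p(1) unfolding expand by (simp add: section_of_def \<Phi>_def \<zeta>_def)
    ultimately show False using contra by blast
  qed
  have v: "A + y' * m + x' + E * \<theta> (\<theta> m) \<noteq> 0" if "m \<in> Ms" for m
  proof
    assume 0: "A + y' * m + x' + E * \<theta> (\<theta> m) = 0"
    have "(m, 1, \<theta> (\<theta> m)) \<in> replacement_part Ms"
      using that by (simp add: replacement_part_def)
    moreover have "(x' + m) * (y' + 1) + (g + \<theta> (\<theta> m)) * (h + \<theta> (\<theta> m)) + u * w = 0"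
      using 0 unfolding expand by (simp add: \<theta>_\<theta>_sq)
    ultimately show False using contra by blast
  qed
  have card_sub: "card (section_of A y' x' 1 E) \<le> (\<Sum>m\<in>Ms. card (section_of A y' x' 1 E \<inter> circle m))"
  proof -
    have "section_of A y' x' 1 E = (\<Union>m\<in>Ms. section_of A y' x' 1 E \<inter> circle m)" using sub by blast
    thus ?thesis using card_UN_le[of Ms "\<lambda>m. section_of A y' x' 1 E \<inter> circle m"] by simp
  qed
  show False
  proof (cases "E = 0")
    case False
    have "CARD('k) < card (section_of A y' x' 1 E) + 2 * n"
      using False by (intro section_lower_bound) simp_all
    also have "card (section_of A y' x' 1 E) \<le> (\<Sum>m\<in>Ms. 2 * n)"
      using card_sub by (rule order_trans) (intro sum_mono card_circle_Int_section False)
    also have "(\<Sum>m\<in>Ms. 2 * n) + 2 * n = Suc (card Ms) * (2 * n)" by simp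
    also have "\<dots> \<le> n * (2 * n)" using Ms(2) by (intro mult_right_mono) simp_all
    finally show False by (simp add: card_eq)
  next
    case True
    obtain a b where ab: "(a, b) \<in> section_of A y' x' 1 E" by (rule section_nonempty[of 1]) simp
    show False
    proof (cases "(x', y') = (a, b)")
      \<comment> \<open>Tangent case: by symmetry, \<open>(a, b) \<in> circle m\<close> says that
        the new point is perpendicular to the replacement point of \<open>m\<close>.\<close>
      case True': True
      obtain m where m: "m \<in> Ms" "(a, b) \<in> circle m" using ab sub by blast
      have "A = \<zeta> a b" using ab True True' by (simp add: section_of_def \<Phi>_def ac_simps)
      hence "A + y' * m + x' = 0" using m(2) True' by (simp add: section_of_def \<Phi>_def ac_simps)
      thus False using v[OF m(1)] True by simp
    next
      case False
      \<comment> \<open>For \<open>circle m\<close> itself the value excluded by \<open>v\<close>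
        would be \<open>m + m = 0\<close>.\<close>
      have "(A, y', x') \<noteq> (0, 1, m)" if "m \<in> Ms" for m using v[OF that] True by auto
      hence "(\<Sum>m\<in>Ms. card (section_of A y' x' 1 E \<inter> circle m)) \<le> (\<Sum>m\<in>Ms. 2)"
        unfolding True by (intro sum_mono card_circle_Int_section0)
      hence "Suc CARD('k) \<le> 2 * card Ms"
        using card_sub card_section0[OF _ False] ab unfolding True by simp
      also have "card Ms \<le> n * n" using Ms(2) by (meson le_square less_imp_le order_trans)
      also have "2 * (n * n) = CARD('k)" by (simp add: card_eq)
      finally show False by simp
    qed
  qed
qed

end

section \<open>Partial spreads as sets of matrices\<close>

locale finite_field_space = vector_space scale
  for scale :: "'k::{field,finite} \<Rightarrow> 'v::ab_group_add \<Rightarrow> 'v"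
begin

lemma card_span:
  assumes "finite S" "independent S"
  shows "finite (span S) \<and> card (span S) = CARD('k) ^ card S"
  using assms
proof (induction S rule: finite_induct)
  case (insert b S)
  have b: "b \<notin> span S" and "independent S"
    using insert.prems insert.hyps(2) by (simp_all add: independent_insert)
  hence IH: "finite (span S)" "card (span S) = CARD('k) ^ card S" using insert.IH by auto
  let ?f = "\<lambda>(c, v). scale c b + v"
  have "span (insert b S) = ?f ` (UNIV \<times> span S)"
  proof (intro equalityI subsetI)
    fix x assume "x \<in> span (insert b S)"
    then obtain c where "x - scale c b \<in> span S" by (auto simp: span_insert)
    thus "x \<in> ?f ` (UNIV \<times> span S)" by (intro image_eqI[of _ _ "(c, x - scale c b)"]) auto
  next
    fix x assume "x \<in> ?f ` (UNIV \<times> span S)"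
    then obtain c v where "v \<in> span S" "x = scale c b + v" by auto
    hence "x - scale c b \<in> span S" by simp
    thus "x \<in> span (insert b S)" unfolding span_insert by blast
  qed
  moreover have "inj_on ?f (UNIV \<times> span S)"
  proof (rule inj_onI, clarify)
    fix c c' v v' assume *: "v \<in> span S" "v' \<in> span S" "scale c b + v = scale c' b + v'"
    have "scale (c - c') b = v' - v" using *(3) by (simp add: scale_left_diff_distrib algebra_simps)
    hence mem: "scale (c - c') b \<in> span S" using *(1,2) by (simp add: span_diff)
    have "c = c'"
    proof (rule ccontr)
      assume "c \<noteq> c'"
      hence "scale (inverse (c - c')) (scale (c - c') b) = b" by simp
      thus False using span_scale[OF mem, of "inverse (c - c')"] b by simp
    qed
    thus "c = c' \<and> v = v'" using *(3) by simp
  qed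
  ultimately show ?case
    using IH insert.hyps by (simp add: card_image card_cartesian_product)
qed simp

lemma card_k_gt_1: "CARD('k) > 1"
proof -
  have "card {0, 1 :: 'k} \<le> CARD('k)" by (rule card_mono) auto
  thus ?thesis by simp
qed

lemma card_subspace:
  assumes "subspace U" "finite U"
  shows "card U = CARD('k) ^ dim U"
proof -
  obtain S where S: "S \<subseteq> U" "independent S" "U \<subseteq> span S" "card S = dim U"
    by (rule basis_exists)
  have "span S = U" using S assms(1) by (simp add: span_subspace)
  thus ?thesis using card_span[OF finite_subset[OF S(1) assms(2)] S(2)] S(4) by simp
qed

lemma dim_eq_iff_card:
  assumes "subspace U" "finite U"
  shows "dim U = d \<longleftrightarrow> card U = CARD('k) ^ d"
  using card_subspace[OF assms] card_k_gt_1 by (simp add: power_inject_exp)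

text \<open>An infinite basis would have \<open>card\<close> 0, so positive dimension provides a
  finite one.\<close>

lemma finite_of_dim_pos:
  assumes "dim (UNIV :: 'v set) > 0"
  shows "finite (UNIV :: 'v set)"
proof -
  obtain S where "S \<subseteq> UNIV" and S: "independent S" "UNIV \<subseteq> span S" "card S = dim (UNIV :: 'v set)"
    by (rule basis_exists)
  have "finite S" by (rule card_ge_0_finite) (use S(3) assms in argo)
  hence "finite (span S)" using card_span[OF _ S(1)] by blast
  thus ?thesis by (rule finite_subset[OF S(2)])
qed

end

section \<open>Hyperbolic coordinates and graphs of matrices\<close>

definition dot :: "'k::field ^ 'n \<Rightarrow> 'k ^ 'n \<Rightarrow> 'k" where
  "dot a b = (\<Sum>i\<in>UNIV. a $ i * b $ i)"

lemma dot_add_left: "dot (a + a') b = dot a b + dot a' b"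
  by (simp add: dot_def distrib_right sum.distrib)

lemma dot_add_right: "dot a (b + b') = dot a b + dot a b'"
  by (simp add: dot_def distrib_left sum.distrib)

lemma dot_0_left [simp]: "dot 0 b = 0"
  by (simp add: dot_def)

lemma dot_axis_left [simp]: "dot (axis i 1) b = b $ i"
  by (simp add: dot_def axis_def if_distrib[of "\<lambda>x. x * _"] cong: if_cong)

lemma matrix_vector_axis [simp]: "((M :: 'k::field ^ 'n ^ 'm) *v axis j 1) $ i = M $ i $ j"
  by (simp add: matrix_vector_mult_def axis_def if_distrib[of "\<lambda>x. _ * x"] cong: if_cong)

locale hyperbolic_frame = finite_field_space scale
  for scale :: "'k::{field,finite} \<Rightarrow> 'v::ab_group_add \<Rightarrow> 'v" +
  fixes Q :: "'v \<Rightarrow> 'k" and emb :: "'k ^ 'n::finite \<Rightarrow> 'k ^ 'n \<Rightarrow> 'v"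
  assumes emb_add: "emb a b + emb a' b' = emb (a + a') (b + b')"
    and emb_scale: "scale c (emb a b) = emb (c *s a) (c *s b)"
    and emb_inj [simp]: "emb a b = emb a' b' \<longleftrightarrow> a = a' \<and> b = b'"
    and emb_surj: "\<exists>a b. v = emb a b"
    and Q_emb: "Q (emb a b) = dot a b"
begin

definition winf :: "'v set" where "winf = range (emb 0)"

definition graph :: "'k ^ 'n ^ 'n \<Rightarrow> 'v set" where "graph M = range (\<lambda>a. emb a (M *v a))"

lemma emb_0 [simp]: "emb 0 0 = 0"
  using emb_add[of 0 0 0 0] by simp

lemma finite_UNIV_space: "finite (UNIV :: 'v set)"
proof -
  have "UNIV = (\<lambda>(a, b). emb a b) ` UNIV"
  proof (rule set_eqI)
    show "v \<in> UNIV \<longleftrightarrow> v \<in> (\<lambda>(a, b). emb a b) ` UNIV" for v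
      using emb_surj[of v] by (auto simp: image_iff)
  qed
  thus ?thesis by (metis finite finite_imageI)
qed

lemma finite_subset_space [simp]: "finite (W :: 'v set)"
  by (rule finite_subset[OF subset_UNIV finite_UNIV_space])

lemma polar_emb: "polar Q (emb a b) (emb a' b') = dot a b' + dot a' b"
  by (simp add: polar_def emb_add Q_emb dot_add_left dot_add_right)

lemma emb_in_graph [simp]: "emb a b \<in> graph M \<longleftrightarrow> b = M *v a"
  by (auto simp: graph_def)

lemma emb_in_winf [simp]: "emb a b \<in> winf \<longleftrightarrow> a = 0"
  by (auto simp: winf_def)

lemma subspace_winf: "subspace winf"
proof (rule subspaceI)
  show "0 \<in> winf" unfolding emb_0[symmetric] emb_in_winf ..
  show "x + y \<in> winf" if "x \<in> winf" "y \<in> winf" for x y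
    using that by (auto simp: winf_def emb_add)
  show "scale c x \<in> winf" if "x \<in> winf" for c x
    using that by (auto simp: winf_def emb_scale)
qed

lemma subspace_graph: "subspace (graph M)"
proof (rule subspaceI)
  show "0 \<in> graph M" unfolding emb_0[symmetric] emb_in_graph by simp
  show "x + y \<in> graph M" if "x \<in> graph M" "y \<in> graph M" for x y
    using that by (auto simp: graph_def emb_add simp flip: matrix_vector_right_distrib)
  show "scale c x \<in> graph M" if "x \<in> graph M" for c x
    using that by (auto simp: graph_def emb_scale simp flip: vector_scalar_commute)
qed

lemma dim_winf: "dim winf = CARD('n)"
  unfolding dim_eq_iff_card[OF subspace_winf finite_subset_space]
  by (simp add: winf_def card_image inj_def)

lemma dim_graph: "dim (graph M) = CARD('n)"
  unfolding dim_eq_iff_card[OF subspace_graph finite_subset_space]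
  by (simp add: graph_def card_image inj_def)

lemma winf_Int_graph: "winf \<inter> graph M = {0}"
proof (rule set_eqI)
  fix v :: 'v
  obtain a b where "v = emb a b" using emb_surj by blast
  thus "v \<in> winf \<inter> graph M \<longleftrightarrow> v \<in> {0}" by (auto simp flip: emb_0)
qed

lemma graph_Int_graph: "graph M \<inter> graph N = {0} \<longleftrightarrow> (\<forall>a. M *v a = N *v a \<longrightarrow> a = 0)"
proof
  assume *: "graph M \<inter> graph N = {0}"
  show "\<forall>a. M *v a = N *v a \<longrightarrow> a = 0"
  proof (intro allI impI)
    fix a assume "M *v a = N *v a"
    hence "emb a (M *v a) \<in> graph M \<inter> graph N" by simp
    hence "emb a (M *v a) = emb 0 0" using * by simp
    thus "a = 0" by (simp del: emb_0)
  qed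
next
  assume *: "\<forall>a. M *v a = N *v a \<longrightarrow> a = 0"
  show "graph M \<inter> graph N = {0}"
  proof (rule set_eqI)
    fix v :: 'v
    obtain a b where "v = emb a b" using emb_surj by blast
    thus "v \<in> graph M \<inter> graph N \<longleftrightarrow> v \<in> {0}" using * by (auto simp flip: emb_0)
  qed
qed

lemma graph_inject [simp]: "graph M = graph N \<longleftrightarrow> M = N"
proof
  assume *: "graph M = graph N"
  have "M *v a = N *v a" for a
    using * emb_in_graph[of a "M *v a" M] emb_in_graph[of a "M *v a" N] by simp
  thus "M = N" by (simp add: matrix_eq)
qed simp

text \<open>Projection to the first coordinate is injective on \<open>W\<close> as \<open>W\<close>
  meets \<open>winf\<close> trivially, and counting makes it surjective.\<close>

lemma complement_eq_graph:
  assumes W: "subspace W" "dim W = CARD('n)" "W \<inter> winf = {0}"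
  obtains M where "W = graph M"
proof -
  define T where "T = {(a, b). emb a b \<in> W}"
  have W_eq: "W = (\<lambda>(a, b). emb a b) ` T"
  proof (rule set_eqI)
    show "v \<in> W \<longleftrightarrow> v \<in> (\<lambda>(a, b). emb a b) ` T" for v
      using emb_surj[of v] by (auto simp: T_def image_iff)
  qed
  have unique: "b = b'" if "emb a b \<in> W" "emb a b' \<in> W" for a b b'
  proof -
    have "emb a b - emb a b' \<in> W" using W(1) that by (rule subspace_diff)
    moreover have "emb a b = emb 0 (b - b') + emb a b'" by (simp add: emb_add)
    ultimately have "emb 0 (b - b') \<in> W \<inter> winf" by simp
    hence "emb 0 (b - b') = emb 0 0" using W(3) by simp
    thus ?thesis by (simp del: emb_0)
  qed
  have "card T = card W" unfolding W_eq by (rule card_image[symmetric]) (auto simp: inj_on_def)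
  also have "\<dots> = CARD('k ^ 'n)" using W dim_eq_iff_card[OF W(1) finite_subset_space] by simp
  finally have "card T = CARD('k ^ 'n)" .
  moreover have "inj_on fst T" using unique by (auto simp: inj_on_def T_def)
  ultimately have "fst ` T = UNIV" by (intro card_subset_eq) (simp_all add: card_image)
  hence "\<exists>b. emb a b \<in> W" for a by (force simp: T_def)
  then obtain f where f: "\<And>a. emb a (f a) \<in> W" by metis
  have "f (a + a') = f a + f a'" for a a'
    using subspace_add[OF W(1) f[of a] f[of a']] f[of "a + a'"] unfolding emb_add by (rule unique[symmetric])
  moreover have "f (c *s a) = c *s f a" for c a
    using subspace_scale[OF W(1) f[of a], of c] f[of "c *s a"] unfolding emb_scale by (rule unique[symmetric])
  ultimately have "Vector_Spaces.linear (*s) (*s) f"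
    by unfold_locales (simp_all add: vector_space_over_itself.scale_left_distrib)
  hence "matrix f *v a = f a" for a by (rule matrix_works)
  hence in_graph: "emb a b \<in> graph (matrix f) \<longleftrightarrow> b = f a" for a b by simp
  have "W = graph (matrix f)"
  proof (rule set_eqI)
    fix v
    obtain a b where v: "v = emb a b" using emb_surj by blast
    show "v \<in> W \<longleftrightarrow> v \<in> graph (matrix f)"
      unfolding v in_graph using f unique by blast
  qed
  thus ?thesis by (rule that)
qed

lemma totally_singular_winf: "totally_singular Q winf"
  by (auto simp: totally_singular_def winf_def Q_emb)

lemma totally_singular_graph: "totally_singular Q (graph M) \<longleftrightarrow> (\<forall>a. dot a (M *v a) = 0)"
  by (auto simp: totally_singular_def graph_def Q_emb)

lemma totally_isotropic_graphD:
  assumes "totally_isotropic (polar Q) (graph M)"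
  shows "M $ i $ j + M $ j $ i = 0"
proof -
  have "polar Q (emb (axis i 1) (M *v axis i 1)) (emb (axis j 1) (M *v axis j 1)) = 0"
    using assms unfolding totally_isotropic_def by (auto simp del: matrix_vector_axis)
  thus ?thesis by (simp add: polar_emb)
qed

end

lemma vector_4 [simp]:
  "(vector [a, b, c, d] :: 'a::zero ^ 4) $ 1 = a" "(vector [a, b, c, d] :: 'a ^ 4) $ 2 = b"
  "(vector [a, b, c, d] :: 'a ^ 4) $ 3 = c" "(vector [a, b, c, d] :: 'a ^ 4) $ 4 = d"
  by (simp_all add: vector_def)

section \<open>Alternating matrices of size 4 and their Pfaffian\<close>

context char_2 begin

definition alternating_matrix :: "'k ^ 4 ^ 4 \<Rightarrow> bool" where
  "alternating_matrix M \<longleftrightarrow> (\<forall>i. M $ i $ i = 0) \<and> (\<forall>i j. M $ i $ j = M $ j $ i)"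

text \<open>The arguments come in pairs of complementary positions (12 and 34, 13 and 24, 14 and
  23), one pair for each term of the Pfaffian.\<close>

definition alt_matrix :: "'k \<Rightarrow> 'k \<Rightarrow> 'k \<Rightarrow> 'k \<Rightarrow> 'k \<Rightarrow> 'k \<Rightarrow> 'k ^ 4 ^ 4" where
  "alt_matrix x y g h u w = vector [vector [0, x, g, u], vector [x, 0, w, h], vector [g, w, 0, y], vector [u, h, y, 0]]"

definition pfaffian :: "'k ^ 4 ^ 4 \<Rightarrow> 'k" where
  "pfaffian M = M $ 1 $ 2 * M $ 3 $ 4 + M $ 1 $ 3 * M $ 2 $ 4 + M $ 1 $ 4 * M $ 2 $ 3"

lemma alternating_alt_matrix: "alternating_matrix (alt_matrix x y g h u w)"
  by (simp add: alternating_matrix_def alt_matrix_def forall_4)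

lemma alternating_matrixE:
  assumes "alternating_matrix M"
  obtains x y g h u w where "M = alt_matrix x y g h u w"
proof -
  have "M = alt_matrix (M $ 1 $ 2) (M $ 3 $ 4) (M $ 1 $ 3) (M $ 2 $ 4) (M $ 1 $ 4) (M $ 2 $ 3)"
  proof -
    have "M $ 1 $ 1 = 0" "M $ 2 $ 2 = 0" "M $ 3 $ 3 = 0" "M $ 4 $ 4 = 0"
      "M $ 2 $ 1 = M $ 1 $ 2" "M $ 3 $ 1 = M $ 1 $ 3" "M $ 4 $ 1 = M $ 1 $ 4"
      "M $ 3 $ 2 = M $ 2 $ 3" "M $ 4 $ 2 = M $ 2 $ 4" "M $ 4 $ 3 = M $ 3 $ 4"
      using assms unfolding alternating_matrix_def by blast+
    thus ?thesis by (simp add: alt_matrix_def vec_eq_iff forall_4)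
  qed
  thus ?thesis by (rule that)
qed

lemma pfaffian_alt_matrix [simp]: "pfaffian (alt_matrix x y g h u w) = x * y + g * h + u * w"
  by (simp add: pfaffian_def alt_matrix_def)

lemma alt_matrix_add:
  "alt_matrix x y g h u w + alt_matrix x' y' g' h' u' w' = alt_matrix (x + x') (y + y') (g + g') (h + h') (u + u') (w + w')"
  by (simp add: alt_matrix_def vec_eq_iff forall_4)

lemma alt_matrix_inject [simp]:
  "alt_matrix x y g h u w = alt_matrix x' y' g' h' u' w' \<longleftrightarrow> x = x' \<and> y = y' \<and> g = g' \<and> h = h' \<and> u = u' \<and> w = w'"
  by (auto simp: alt_matrix_def vec_eq_iff forall_4)

lemma alt_matrix_mult:
  "alt_matrix x y g h u w *v a = vector [x * a $ 2 + g * a $ 3 + u * a $ 4, x * a $ 1 + w * a $ 3 + h * a $ 4,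
    g * a $ 1 + w * a $ 2 + y * a $ 4, u * a $ 1 + h * a $ 2 + y * a $ 3]"
  by (simp add: alt_matrix_def vec_eq_iff forall_4 matrix_vector_mult_def sum_4)

lemma dot_alternating: "alternating_matrix M \<Longrightarrow> dot a (M *v a) = 0"
  by (erule alternating_matrixE) (simp add: alt_matrix_mult dot_def sum_4 algebra_simps)

lemma alternatingI:
  assumes "\<And>a. dot a (M *v a) = (0::'k)" "\<And>i j. M $ i $ j = M $ j $ i"
  shows "alternating_matrix M"
  using assms(1)[of "axis _ 1"] assms(2) unfolding alternating_matrix_def by simp

text \<open>The matrix with complementary entries is the Pfaffian adjoint.\<close>

lemma alt_matrix_adjoint:
  "alt_matrix x y g h u w *v (alt_matrix y x h g w u *v a) = (x * y + g * h + u * w) *s a"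
  by (simp add: alt_matrix_mult vec_eq_iff forall_4 algebra_simps)

lemma alternating_kernel_trivial:
  assumes "alternating_matrix M" "pfaffian M \<noteq> 0" "M *v a = 0"
  shows "a = 0"
proof -
  obtain x y g h u w where M: "M = alt_matrix x y g h u w"
    using assms(1) by (rule alternating_matrixE)
  have "(y * x + h * g + w * u) *s a = 0"
    using alt_matrix_adjoint[of y x h g w u a] assms(3) by (simp add: M)
  moreover have "y * x + h * g + w * u \<noteq> 0" using assms(2) by (simp add: M mult.commute)
  ultimately show ?thesis by (simp only: vector_mul_eq_0) simp
qed

text \<open>The kernel has dimension at least 2, hence meets every hyperplane. Explicitly, the
  adjoint \<open>N\<close> maps into it and \<open>N *v d\<close> is orthogonal to \<open>d\<close>;
  if \<open>N *v d = 0\<close>, any nonzero column of \<open>N\<close> serves.\<close>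

lemma alternating_kernel:
  assumes "alternating_matrix M" "pfaffian M = 0"
  obtains a :: "'k ^ 4" where "a \<noteq> 0" "M *v a = 0" "dot d a = 0"
proof (cases "M = 0")
  case True
  define a :: "'k ^ 4" where "a = (if d $ 1 = 0 \<and> d $ 2 = 0 then axis 1 1 else vector [d $ 2, d $ 1, 0, 0])"
  have "a $ 1 \<noteq> 0 \<or> a $ 2 \<noteq> 0" by (auto simp: a_def axis_def)
  hence "a \<noteq> 0" by auto
  moreover have "dot d a = 0" by (auto simp: a_def dot_def sum_4 axis_def algebra_simps)
  ultimately show ?thesis using that True by simp
next
  case False
  obtain x y g h u w where M: "M = alt_matrix x y g h u w"
    using assms(1) by (rule alternating_matrixE)
  define N where "N = alt_matrix y x h g w u"
  have MN: "M *v (N *v a) = 0" for a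
    using assms(2) by (simp add: M N_def alt_matrix_adjoint)
  show ?thesis
  proof (cases "N *v d = 0")
    case False
    have "alternating_matrix N" unfolding N_def by (rule alternating_alt_matrix)
    thus ?thesis using that[OF False MN] dot_alternating by blast
  next
    case True
    have "N \<noteq> 0"
    proof
      assume "N = 0"
      hence "N = alt_matrix 0 0 0 0 0 0" by (simp add: alt_matrix_def vec_eq_iff forall_4)
      hence "M = alt_matrix 0 0 0 0 0 0" by (simp add: M N_def)
      thus False using \<open>M \<noteq> 0\<close> by (simp add: alt_matrix_def vec_eq_iff forall_4)
    qed
    then obtain j where j: "N *v axis j 1 \<noteq> 0"
      by (metis matrix_vector_axis vec_eq_iff zero_index)
    have "N $ i $ j = N $ j $ i" for i
      using alternating_alt_matrix[of y x h g w u] unfolding N_def alternating_matrix_def by blast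
    hence "dot d (N *v axis j 1) = (N *v d) $ j"
      by (simp add: dot_def matrix_vector_mult_def[of N d] mult.commute)
    thus ?thesis using that[OF j MN] True by simp
  qed
qed

end

section \<open>Partial spreads containing \<open>winf\<close>\<close>

locale hyperbolic_8_space = char_2 "TYPE('k)" + hyperbolic_frame scale Q emb
  for scale :: "'k::{field,finite} \<Rightarrow> 'v::ab_group_add \<Rightarrow> 'v" and Q :: "'v \<Rightarrow> 'k"
    and emb :: "'k ^ 4 \<Rightarrow> 'k ^ 4 \<Rightarrow> 'v"
begin

lemma graph_Int_graph_pfaffian:
  assumes "alternating_matrix M" "alternating_matrix N"
  shows "graph M \<inter> graph N = {0} \<longleftrightarrow> pfaffian (M + N) \<noteq> 0"
proof -
  have alt: "alternating_matrix (M + N)" using assms by (simp add: alternating_matrix_def)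
  have "M *v a = N *v a \<longleftrightarrow> (M + N) *v a = 0" for a
    by (simp add: matrix_vector_mult_add_rdistrib vec_eq_iff)
  thus ?thesis
    unfolding graph_Int_graph using alternating_kernel_trivial[OF alt] alternating_kernel[OF alt] by metis
qed

lemma partial_spread_graphs:
  assumes T: "\<And>M. M \<in> T \<Longrightarrow> alternating_matrix M"
    and "\<And>M N. M \<in> T \<Longrightarrow> N \<in> T \<Longrightarrow> M \<noteq> N \<Longrightarrow> pfaffian (M + N) \<noteq> 0"
  shows "orthogonal_partial_spread scale Q (insert winf (graph ` T))"
  using assms graph_Int_graph_pfaffian winf_Int_graph dot_alternating
  unfolding orthogonal_partial_spread_def
  by (auto simp: subspace_winf subspace_graph dim_winf dim_graph totally_singular_winf totally_singular_graph
      Int_commute[of _ winf])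

lemma totally_singular_complement:
  assumes "subspace W" "dim W = 4" "totally_isotropic (polar Q) W" "W \<inter> winf = {0}"
  obtains M where "W = graph M" "\<forall>i j. M $ i $ j = M $ j $ i"
proof -
  obtain M where M: "W = graph M"
    using complement_eq_graph[of W] assms(1,2,4) by auto
  have "M $ i $ j = M $ j $ i" for i j
    using totally_isotropic_graphD[of M i j] assms(3) unfolding M by simp
  thus ?thesis using M that by blast
qed

lemma totally_singular_imp_isotropic:
  assumes "subspace U" "totally_singular Q U"
  shows "totally_isotropic (polar Q) U"
  using assms subspace_add by (auto simp: totally_isotropic_def totally_singular_def polar_def)

lemma orthogonal_imp_symplectic:
  "orthogonal_partial_spread scale Q \<Sigma> \<Longrightarrow> symplectic_partial_spread scale (polar Q) \<Sigma>"
  unfolding orthogonal_partial_spread_def symplectic_partial_spread_def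
  using totally_singular_imp_isotropic by blast

lemma spread_member:
  assumes "orthogonal_partial_spread scale Q \<Sigma>" "winf \<in> \<Sigma>" "U \<in> \<Sigma>" "U \<noteq> winf"
  obtains M where "U = graph M" "alternating_matrix M"
proof -
  have U: "subspace U" "dim U = 4" "totally_singular Q U" "U \<inter> winf = {0}"
    using assms unfolding orthogonal_partial_spread_def by auto
  obtain M where M: "U = graph M" "\<forall>i j. M $ i $ j = M $ j $ i"
    using totally_singular_complement[OF U(1,2) totally_singular_imp_isotropic[OF U(1,3)] U(4)] by blast
  have "alternating_matrix M"
    using U(3) M(2) unfolding M(1) totally_singular_graph by (intro alternatingI) auto
  thus ?thesis using that M(1) by blast
qed

lemma maximal_partial_spread_graphs:
  assumes T: "\<And>M. M \<in> T \<Longrightarrow> alternating_matrix M"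
    and pairwise: "\<And>M N. M \<in> T \<Longrightarrow> N \<in> T \<Longrightarrow> M \<noteq> N \<Longrightarrow> pfaffian (M + N) \<noteq> 0"
    and max: "\<And>M. alternating_matrix M \<Longrightarrow> \<exists>N\<in>T. pfaffian (M + N) = 0"
  shows "maximal_orthogonal_partial_spread scale Q (insert winf (graph ` T))"
  unfolding maximal_orthogonal_partial_spread_def
proof (intro conjI notI)
  show "orthogonal_partial_spread scale Q (insert winf (graph ` T))"
    using T pairwise by (rule partial_spread_graphs)
  assume "\<exists>\<Sigma>'. orthogonal_partial_spread scale Q \<Sigma>' \<and> insert winf (graph ` T) \<subset> \<Sigma>'"
  then obtain \<Sigma>' U where \<Sigma>': "orthogonal_partial_spread scale Q \<Sigma>'" "insert winf (graph ` T) \<subseteq> \<Sigma>'"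
    and U: "U \<in> \<Sigma>'" "U \<notin> insert winf (graph ` T)" by blast
  obtain M where M: "U = graph M" "alternating_matrix M"
    using spread_member[OF \<Sigma>'(1) _ U(1)] \<Sigma>'(2) U(2) by blast
  obtain N where N: "N \<in> T" "pfaffian (M + N) = 0" using max[OF M(2)] by blast
  have "U \<inter> graph N = {0}"
    using \<Sigma>' U N(1) unfolding orthogonal_partial_spread_def by blast
  thus False using graph_Int_graph_pfaffian[OF M(2) T[OF N(1)]] N(2) M(1) by simp
qed

text \<open>
  A totally isotropic complement of \<^term>\<open>winf\<close> is the graph of a symmetric matrix \<open>N\<close>. Let \<open>d\<close> be the
  vector of square roots of the diagonal of \<open>N\<close>. Then \<open>N + d d\<^sup>T\<close> is alternating, and adding \<open>d d\<^sup>T\<close> does not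
  make a singular alternating \<open>4 \<times> 4\<close> matrix invertible, so its graph extends every orthogonal
  partial spread that the graph of \<open>N\<close> extends.
\<close>

theorem maximal_orthogonal_imp_symplectic:
  assumes max: "maximal_orthogonal_partial_spread scale Q \<Sigma>" and winf: "winf \<in> \<Sigma>"
    and sqrt: "\<And>x :: 'k. \<exists>y. y\<^sup>2 = x"
  shows "maximal_symplectic_partial_spread scale (polar Q) \<Sigma>"
  unfolding maximal_symplectic_partial_spread_def
proof (intro conjI notI)
  have \<Sigma>: "orthogonal_partial_spread scale Q \<Sigma>"
    using max by (simp add: maximal_orthogonal_partial_spread_def)
  thus "symplectic_partial_spread scale (polar Q) \<Sigma>" by (rule orthogonal_imp_symplectic)
  assume "\<exists>\<Sigma>'. symplectic_partial_spread scale (polar Q) \<Sigma>' \<and> \<Sigma> \<subset> \<Sigma>'"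
  then obtain \<Sigma>' W where \<Sigma>': "symplectic_partial_spread scale (polar Q) \<Sigma>'" "\<Sigma> \<subseteq> \<Sigma>'"
    and W: "W \<in> \<Sigma>'" "W \<notin> \<Sigma>" by blast
  have W': "subspace W" "dim W = 4" "totally_isotropic (polar Q) W"
    using \<Sigma>'(1) W(1) by (simp_all add: symplectic_partial_spread_def)
  have disj: "W \<inter> U = {0}" if "U \<in> \<Sigma>" for U
  proof -
    have "U \<in> \<Sigma>'" "W \<noteq> U" using that \<Sigma>'(2) W(2) by auto
    thus ?thesis using \<Sigma>'(1) W(1) unfolding symplectic_partial_spread_def by blast
  qed
  obtain N where N: "W = graph N" "\<forall>i j. N $ i $ j = N $ j $ i"
    by (rule totally_singular_complement[OF W' disj[OF winf]])
  obtain r where r: "\<And>x :: 'k. (r x)\<^sup>2 = x" using sqrt by metis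
  define d :: "'k ^ 4" where "d = (\<chi> i. r (N $ i $ i))"
  define D :: "'k ^ 4 ^ 4" where "D = (\<chi> i j. d $ i * d $ j)"
  have D: "D *v a = dot d a *s d" for a
    by (simp add: D_def vec_eq_iff matrix_vector_mult_def dot_def sum_distrib_left sum_distrib_right ac_simps)
  have alt: "alternating_matrix (N + D)"
    using N(2) by (simp add: alternating_matrix_def D_def d_def r mult.commute flip: power2_eq_square)
  have pf: "pfaffian (N + D + M) \<noteq> 0" if M: "alternating_matrix M" "graph M \<in> \<Sigma>" for M
  proof
    assume "pfaffian (N + D + M) = 0"
    moreover have "alternating_matrix (N + D + M)" using alt M(1) by (simp add: alternating_matrix_def)
    ultimately obtain a where a: "a \<noteq> 0" "(N + D + M) *v a = 0" "dot d a = 0"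
      using alternating_kernel by blast
    \<comment> \<open>The condition \<open>dot d a = 0\<close> removes the rank one summand
      \<open>D\<close>.\<close>
    have "N *v a = M *v a"
      using a(2,3) by (simp add: matrix_vector_mult_add_rdistrib D vec_eq_iff)
    thus False using disj[OF M(2)] a(1) unfolding N(1) graph_Int_graph by blast
  qed
  have "orthogonal_partial_spread scale Q (insert (graph (N + D)) \<Sigma>)"
  proof -
    have "graph (N + D) \<inter> U = {0}" if U: "U \<in> \<Sigma>" for U
    proof (cases "U = winf")
      case True
      thus ?thesis using winf_Int_graph[of "N + D"] by (simp add: Int_commute)
    next
      case False
      then obtain M where M: "U = graph M" "alternating_matrix M" using spread_member[OF \<Sigma> winf U] by blast
      thus ?thesis using graph_Int_graph_pfaffian[OF alt M(2)] pf[OF M(2)] U by simp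
    qed
    thus ?thesis using \<Sigma> dot_alternating[OF alt] unfolding orthogonal_partial_spread_def
      by (auto simp: subspace_graph dim_graph totally_singular_graph Int_commute)
  qed
  moreover have "graph (N + D) \<notin> \<Sigma>"
  proof
    assume "graph (N + D) \<in> \<Sigma>"
    from pf[OF alt this] show False by (simp add: pfaffian_def)
  qed
  ultimately show False using max unfolding maximal_orthogonal_partial_spread_def by blast
qed

end

section \<open>Hyperbolic coordinates\<close>

locale symplectic_space = finite_field_space scale + char_2 "TYPE('k)"
  for scale :: "'k::{field,finite} \<Rightarrow> 'v::ab_group_add \<Rightarrow> 'v" +
  fixes B :: "'v \<Rightarrow> 'v \<Rightarrow> 'k"
  assumes bilinear: "bilinear_form scale B" and alternating: "alternating B"
begin

lemma B_add_right: "B u (v + w) = B u v + B u w"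
  using bilinear unfolding bilinear_form_def Vector_Spaces.linear_iff by blast

lemma B_add_left: "B (u + v) w = B u w + B v w"
  using bilinear unfolding bilinear_form_def Vector_Spaces.linear_iff by blast

lemma B_scale_right: "B u (scale c v) = c * B u v"
  using bilinear unfolding bilinear_form_def Vector_Spaces.linear_iff by blast

lemma B_scale_left: "B (scale c u) v = c * B u v"
  using bilinear unfolding bilinear_form_def Vector_Spaces.linear_iff by blast

lemma B_0_right [simp]: "B u 0 = 0"
  using B_scale_right[of u 0 0] by simp

lemma B_0_left [simp]: "B 0 u = 0"
  using B_scale_left[of 0 0 u] by simp

lemma B_sum_right: "B u (sum f S) = (\<Sum>i\<in>S. B u (f i))"
  by (induction S rule: infinite_finite_induct) (simp_all add: B_add_right)

lemma B_sum_left: "B (sum f S) u = (\<Sum>i\<in>S. B (f i) u)"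
  by (induction S rule: infinite_finite_induct) (simp_all add: B_add_left)

lemma B_self [simp]: "B u u = 0"
  using alternating by (simp add: alternating_def)

lemma B_sym: "B u v = B v u"
  using B_self[of "u + v"] by (simp add: B_add_left B_add_right del: B_self) simp

text \<open>The double perpendicular adds nothing to a span. If \<open>s\<close> is not redundant,
  some \<open>w\<close> perpendicular to \<open>S\<close> detects it, and subtracting a multiple of
  \<open>s\<close> makes \<open>x\<close> perpendicular to \<open>w\<close>.\<close>

lemma perp_imp_in_span:
  assumes "finite S" "subspace U" "\<forall>u\<in>U. (\<forall>v. B u v = 0) \<longrightarrow> u = 0"
    and "S \<subseteq> U" "x \<in> U" "\<forall>v. (\<forall>s\<in>S. B s v = 0) \<longrightarrow> B x v = 0"
  shows "x \<in> span S"
  using assms(1,4-6)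
proof (induction S arbitrary: x rule: finite_induct)
  case empty
  thus ?case using assms(3) by simp
next
  case (insert s S)
  show ?case
  proof (cases "\<forall>v. (\<forall>t\<in>S. B t v = 0) \<longrightarrow> B s v = 0")
    case True
    have "x \<in> span S"
    proof (rule insert.IH)
      show "\<forall>v. (\<forall>t\<in>S. B t v = 0) \<longrightarrow> B x v = 0" using True insert.prems(3) by simp
    qed (use insert.prems in auto)
    thus ?thesis using span_mono[of S "insert s S"] by blast
  next
    case False
    then obtain w where w: "\<And>t. t \<in> S \<Longrightarrow> B t w = 0" "B s w \<noteq> 0" by blast
    define c where "c = B x w / B s w"
    have "x - scale c s \<in> span S"
    proof (rule insert.IH)
      show "x - scale c s \<in> U"
        using assms(2) insert.prems by (simp add: subspace_diff subspace_scale)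
      show "\<forall>v. (\<forall>t\<in>S. B t v = 0) \<longrightarrow> B (x - scale c s) v = 0"
      proof (intro allI impI)
        fix v assume v: "\<forall>t\<in>S. B t v = 0"
        define v' where "v' = v + scale (B s v / B s w) w"
        have "B t v' = 0" if "t \<in> insert s S" for t
          using that v w by (auto simp: v'_def B_add_right B_scale_right)
        hence "B x v' = 0" using insert.prems(3) by blast
        moreover have "x = (x - scale c s) + scale c s" by simp
        hence "B x v = B (x - scale c s) v + c * B s v" by (metis B_add_left B_scale_left)
        ultimately show "B (x - scale c s) v = 0"
          by (simp add: v'_def B_add_right B_scale_right c_def ac_simps)
      qed
    qed (use insert.prems in auto)
    thus ?thesis unfolding span_insert by blast
  qed
qed

lemma dual_vector:
  assumes "finite S" "independent S" "\<forall>u\<in>span S. (\<forall>v. B u v = 0) \<longrightarrow> u = 0" "s \<in> S"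
  shows "\<exists>g. \<forall>t\<in>S. B t g = (if t = s then 1 else 0)"
proof -
  have "s \<notin> span (S - {s})" using assms(2,4) by (auto simp: dependent_def)
  moreover have "S - {s} \<subseteq> span S" "s \<in> span S" using assms(4) span_superset[of S] by auto
  ultimately have "\<not> (\<forall>v. (\<forall>t\<in>S - {s}. B t v = 0) \<longrightarrow> B s v = 0)"
    using perp_imp_in_span[OF finite_Diff[OF assms(1)] subspace_span assms(3)] by metis
  then obtain v where v: "\<And>t. t \<in> S - {s} \<Longrightarrow> B t v = 0" "B s v \<noteq> 0" by blast
  have "\<forall>t\<in>S. B t (scale (1 / B s v) v) = (if t = s then 1 else 0)"
    using v by (auto simp: B_scale_right)
  thus ?thesis by blast
qed

text \<open>If no vector outside the span were perpendicular to \<open>S\<close>, then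
  \<open>S\<close> with a dual family would span the space, using at most
  \<open>2 * k < 2 * m\<close> vectors.\<close>

lemma isotropic_independent_set:
  assumes nondeg: "nondegenerate B" and dim: "dim (UNIV :: 'v set) = 2 * m" and "k \<le> m"
  shows "\<exists>S. finite S \<and> card S = k \<and> independent S \<and> (\<forall>x\<in>S. \<forall>y\<in>S. B x y = 0)"
  using \<open>k \<le> m\<close>
proof (induction k)
  case 0
  show ?case by (intro exI[of _ "{}"]) (simp add: independent_empty)
next
  case (Suc k)
  then obtain S where S: "finite S" "card S = k" "independent S" "\<And>x y. x \<in> S \<Longrightarrow> y \<in> S \<Longrightarrow> B x y = 0"
    by fastforce
  have nd: "\<forall>u\<in>span S. (\<forall>v. B u v = 0) \<longrightarrow> u = 0" using nondeg by (simp add: nondegenerate_def)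
  obtain g where g: "\<And>s t. s \<in> S \<Longrightarrow> t \<in> S \<Longrightarrow> B t (g s) = (if t = s then 1 else 0)"
    using dual_vector[OF S(1,3) nd] by metis
  have "\<exists>w. w \<notin> span S \<and> (\<forall>s\<in>S. B s w = 0)"
  proof (rule ccontr)
    assume "\<not> ?thesis"
    hence perp: "w \<in> span S" if "\<And>s. s \<in> S \<Longrightarrow> B s w = 0" for w using that by blast
    have "v \<in> span (S \<union> g ` S)" for v
    proof -
      define p where "p = (\<Sum>s\<in>S. scale (B s v) (g s))"
      have "B t p = B t v" if "t \<in> S" for t
      proof -
        have "B t p = (\<Sum>s\<in>S. if s = t then B s v else 0)"
          unfolding p_def B_sum_right by (rule sum.cong) (use g that in \<open>auto simp: B_scale_right\<close>)
        thus ?thesis using S(1) that by simp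
      qed
      moreover have "B t v = B t (v - p) + B t p" for t using B_add_right[of t "v - p" p] by simp
      ultimately have "v - p \<in> span S" by (intro perp) (metis add_cancel_left_left)
      moreover have "p \<in> span (g ` S)"
        unfolding p_def by (intro span_sum span_scale span_base imageI)
      ultimately have "(v - p) + p \<in> span (S \<union> g ` S)"
        by (intro span_add) (use span_mono[of S "S \<union> g ` S"] span_mono[of "g ` S" "S \<union> g ` S"] in auto)
      thus ?thesis by simp
    qed
    hence "dim (UNIV :: 'v set) \<le> card (S \<union> g ` S)" by (intro dim_le_card) (use S(1) in auto)
    also have "\<dots> \<le> card S + card (g ` S)" by (rule card_Un_le)
    also have "card (g ` S) \<le> card S" using S(1) by (rule card_image_le)
    finally show False using Suc.prems dim S(2) by simp
  qed
  then obtain w where w: "w \<notin> span S" "\<And>s. s \<in> S \<Longrightarrow> B s w = 0" by blast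
  show ?case
  proof (intro exI[of _ "insert w S"] conjI)
    show "card (insert w S) = Suc k" using S w(1) span_superset[of S] by (subst card_insert_disjoint) auto
    show "independent (insert w S)" using S(3) w(1) by (simp add: independent_insert)
    show "\<forall>x\<in>insert w S. \<forall>y\<in>insert w S. B x y = 0" using S(4) w(2) B_sym by auto
  qed (use S(1) in simp)
qed

lemma dual_isotropic_family:
  fixes e :: "'n::finite \<Rightarrow> 'v"
  assumes e: "inj e" "independent (range e)" "\<And>i j. B (e i) (e j) = 0"
    and nd: "\<forall>u\<in>span (range e). (\<forall>v. B u v = 0) \<longrightarrow> u = 0"
  obtains f where "\<And>i j. B (e i) (f j) = (if i = j then 1 else 0)" "\<And>i j. B (f i) (f j) = 0"
proof -
  have "\<exists>g. \<forall>t\<in>range e. B t g = (if t = e j then 1 else 0)" for j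
    by (rule dual_vector[OF _ e(2) nd]) simp_all
  then obtain g where "\<And>j. \<forall>t\<in>range e. B t (g j) = (if t = e j then 1 else 0)" by metis
  hence g: "B (e i) (g j) = (if i = j then 1 else 0)" for i j using e(1) by (simp add: inj_eq)
  \<comment> \<open>An arbitrary ordering of the indices, so that only one of \<open>c j k\<close>
    and \<open>c k j\<close> carries the correction \<open>B (g j) (g k)\<close>.\<close>
  obtain h :: "'n \<Rightarrow> nat" where h: "inj h" using finite_imp_inj_to_nat_seg[of "UNIV :: 'n set"] by auto
  define c where "c i j = (if h i < h j then B (g i) (g j) else 0)" for i j
  define f where "f j = g j + (\<Sum>i\<in>UNIV. scale (c i j) (e i))" for j
  have ef: "B (e i) (f j) = (if i = j then 1 else 0)" for i j
    by (simp add: f_def B_add_right B_sum_right B_scale_right e(3) g)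
  have gf: "B (f j) (f k) = B (g j) (g k) + c k j + c j k" for j k
  proof -
    have "B (f j) (f k) = B (g j) (f k) + (\<Sum>i\<in>UNIV. c i j * B (e i) (f k))"
      by (simp add: f_def[of j] B_add_left B_sum_left B_scale_left)
    also have "(\<Sum>i\<in>UNIV. c i j * B (e i) (f k)) = c k j" by (simp add: ef if_distrib cong: if_cong)
    also have "B (g j) (f k) = B (g j) (g k) + (\<Sum>i\<in>UNIV. c i k * B (e i) (g j))"
      by (simp add: f_def B_add_right B_sum_right B_scale_right B_sym[of "g j" "e _"])
    also have "(\<Sum>i\<in>UNIV. c i k * B (e i) (g j)) = c j k" by (simp add: g if_distrib cong: if_cong)
    finally show ?thesis by (simp add: ac_simps)
  qed
  have "B (f j) (f k) = 0" for j k
  proof (cases "j = k")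
    case False
    hence "h j \<noteq> h k" using h by (simp add: inj_eq)
    thus ?thesis unfolding gf c_def using B_sym[of "g k" "g j"] by (cases "h j < h k") simp_all
  qed simp
  thus ?thesis using that ef by blast
qed

definition hyperbolic_sum :: "('n::finite \<Rightarrow> 'v) \<Rightarrow> ('n \<Rightarrow> 'v) \<Rightarrow> 'k ^ 'n \<Rightarrow> 'k ^ 'n \<Rightarrow> 'v" where
  "hyperbolic_sum e f a b = (\<Sum>i\<in>UNIV. scale (a $ i) (f i)) + (\<Sum>i\<in>UNIV. scale (b $ i) (e i))"

text \<open>Pairing with \<open>e\<close> and \<open>f\<close> recovers the coordinates, which gives
  injectivity; surjectivity follows by counting.\<close>

lemma hyperbolic_coordinates:
  fixes e f :: "'n::finite \<Rightarrow> 'v"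
  assumes ee: "\<And>i j. B (e i) (e j) = 0" and ff: "\<And>i j. B (f i) (f j) = 0"
    and ef: "\<And>i j. B (e i) (f j) = (if i = j then 1 else 0)"
    and dim: "dim (UNIV :: 'v set) = 2 * CARD('n)"
  defines "emb \<equiv> hyperbolic_sum e f"
  shows "emb a b + emb a' b' = emb (a + a') (b + b')"
    and "scale c (emb a b) = emb (c *s a) (c *s b)"
    and "B (emb a b) (emb a' b') = dot a b' + dot a' b"
    and "emb a b = emb a' b' \<longleftrightarrow> a = a' \<and> b = b'"
    and "\<exists>a b. v = emb a b"
proof -
  have emb_def: "emb a b = (\<Sum>i\<in>UNIV. scale (a $ i) (f i)) + (\<Sum>i\<in>UNIV. scale (b $ i) (e i))" for a b
    by (simp add: assms(5) hyperbolic_sum_def)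
  show add: "emb a b + emb a' b' = emb (a + a') (b + b')" for a b a' b'
    by (simp add: emb_def scale_left_distrib sum.distrib)
  show "scale c (emb a b) = emb (c *s a) (c *s b)"
    by (simp add: emb_def scale_right_distrib scale_sum_right)
  have fe: "B (f i) (e j) = (if i = j then 1 else 0)" for i j
    unfolding B_sym[of "f i"] ef by auto
  have Be: "B (emb a b) (e i) = a $ i" for a b i
    by (simp add: emb_def B_add_left B_sum_left B_scale_left ee fe if_distrib cong: if_cong)
  have Bf: "B (emb a b) (f i) = b $ i" for a b i
    by (simp add: emb_def B_add_left B_sum_left B_scale_left ff ef if_distrib cong: if_cong)
  show "B (emb a b) (emb a' b') = dot a b' + dot a' b"
    unfolding emb_def[of a' b'] B_add_right B_sum_right B_scale_right Be Bf
    by (simp add: dot_def mult.commute add.commute)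
  show inj: "emb a b = emb a' b' \<longleftrightarrow> a = a' \<and> b = b'" for a b a' b'
  proof
    assume eq: "emb a b = emb a' b'"
    have "a $ i = a' $ i" "b $ i = b' $ i" for i
      using Be[of a b i] Be[of a' b' i] Bf[of a b i] Bf[of a' b' i] eq by simp_all
    thus "a = a' \<and> b = b'" by (simp add: vec_eq_iff)
  qed simp
  have "dim (UNIV :: 'v set) > 0" using dim by simp
  hence fin: "finite (UNIV :: 'v set)" by (rule finite_of_dim_pos)
  have "card (range (\<lambda>(a, b). emb a b)) = CARD(('k ^ 'n) \<times> ('k ^ 'n))"
    by (rule card_image) (auto simp: inj_def inj)
  also have "\<dots> = CARD('k) ^ (2 * CARD('n))" by (simp add: mult_2 power_add)
  also have "\<dots> = card (UNIV :: 'v set)" using card_subspace[OF subspace_UNIV fin] dim by simp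
  finally have "range (\<lambda>(a, b). emb a b) = UNIV" by (intro card_subset_eq fin) auto
  hence "v \<in> range (\<lambda>(a, b). emb a b)" by simp
  thus "\<exists>a b. v = emb a b" by auto
qed

text \<open>The form \<open>dot a b\<close> in symplectic coordinates polarizes to \<open>B\<close>,
  which reduces the symplectic claim to the orthogonal construction.\<close>

lemma symplectic_frame:
  assumes "nondegenerate B" "dim (UNIV :: 'v set) = 8"
  obtains Q and emb :: "'k ^ 4 \<Rightarrow> 'k ^ 4 \<Rightarrow> 'v"
    where "hyperbolic_8_space scale Q emb" "polar Q = B"
proof -
  obtain S where S: "finite S" "card S = 4" "independent S" "\<And>x y. x \<in> S \<Longrightarrow> y \<in> S \<Longrightarrow> B x y = 0"
    using isotropic_independent_set[OF assms(1), of 4 4] assms(2) by auto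
  obtain e :: "4 \<Rightarrow> 'v" where e: "bij_betw e UNIV S"
    using S(1,2) finite_same_card_bij[of "UNIV :: 4 set" S] by auto
  hence re: "range e = S" and "inj e" by (simp_all add: bij_betw_def)
  have nd: "\<forall>u\<in>span (range e). (\<forall>v. B u v = 0) \<longrightarrow> u = 0" using assms(1) by (simp add: nondegenerate_def)
  have ee: "B (e i) (e j) = 0" for i j using S(4) re by blast
  obtain f where f: "\<And>i j. B (e i) (f j) = (if i = j then 1 else 0)" "\<And>i j. B (f i) (f j) = 0"
    using dual_isotropic_family[OF \<open>inj e\<close> _ ee nd] S(3) re by blast
  have "dim (UNIV :: 'v set) = 2 * CARD(4)" using assms(2) by simp
  note hc = hyperbolic_coordinates[OF ee f(2,1) this]
  define emb where "emb = hyperbolic_sum e f"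
  note hc = hc[folded emb_def]
  define Q where "Q v = (case inv (\<lambda>(a, b). emb a b) v of (a, b) \<Rightarrow> dot a b)" for v
  have "inj (\<lambda>(a, b). emb a b)" by (auto simp: inj_def hc(4))
  from inv_f_f[OF this] have Q: "Q (emb a b) = dot a b" for a b
    by (simp add: Q_def) (metis case_prod_conv)
  have frame: "hyperbolic_8_space scale Q emb"
    by unfold_locales (use hc Q in auto)
  interpret hyperbolic_8_space scale Q emb by (rule frame)
  have "polar Q u v = B u v" for u v
    using hc(5)[of u] hc(5)[of v] by (auto simp: polar_emb hc(3))
  thus ?thesis using that[OF frame] by blast
qed

end

text \<open>Any totally singular 4-space can take the role of \<open>winf\<close>, hence so can any
  member of a given partial spread.\<close>

lemma (in finite_field_space) orthogonal_frame:
  assumes two: "(2::'k) = 0"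
    and Q: "nondegenerate_quadratic_form scale Q" and dim: "dim (UNIV :: 'v set) = 8"
    and U: "subspace U" "dim U = 4" "totally_singular Q U"
  obtains emb :: "'k ^ 4 \<Rightarrow> 'k ^ 4 \<Rightarrow> 'v"
    where "hyperbolic_8_space scale Q emb" "range (emb 0) = U"
proof -
  interpret char_2 "TYPE('k)" by unfold_locales (rule two)
  have quad: "Q (scale a v) = a\<^sup>2 * Q v" "bilinear_form scale (polar Q)" for a v
    using Q unfolding nondegenerate_quadratic_form_def quadratic_form_def by blast+
  have Q0: "Q 0 = 0" using quad(1)[of 0 0] by simp
  have "polar Q v v = 0" for v
    using quad(1)[of 2 v] by (simp add: polar_def) (metis scale_one two add_self scale_left_distrib one_add_one Q0 scale_zero_left)
  then interpret symplectic_space scale "polar Q"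
    using quad(2) by unfold_locales (simp_all add: alternating_def)
  have Q_add: "Q (u + v) = Q u + Q v + polar Q u v" for u v by (simp add: polar_def ac_simps)
  have Q_sum: "Q (\<Sum>i\<in>A. scale (a i) (g i)) = 0"
    if "\<And>i. Q (g i) = 0" "\<And>i j. polar Q (g i) (g j) = 0" "finite A" for A :: "4 set" and a g
    using that(3)
    by (induction A rule: finite_induct)
      (simp_all add: Q0 Q_add quad(1) that(1,2) B_sum_right B_scale_right B_scale_left)
  have iso: "polar Q u v = 0" if "u \<in> U" "v \<in> U" for u v
    using that U(1,3) subspace_add[of U] by (simp add: totally_singular_def polar_def)
  obtain S where S: "S \<subseteq> U" "independent S" "U \<subseteq> span S" "card S = dim U"
    by (rule basis_exists)
  have "finite S" by (rule card_ge_0_finite) (use S(4) U(2) in simp)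
  have "span S = U" using S U(1) by (simp add: span_subspace)
  obtain e :: "4 \<Rightarrow> 'v" where e: "bij_betw e UNIV S"
    using \<open>finite S\<close> S(4) U(2) finite_same_card_bij[of "UNIV :: 4 set" S] by auto
  hence re: "range e = S" and "inj e" by (simp_all add: bij_betw_def)
  have eU: "e i \<in> U" for i using re S(1) by blast
  have nd: "\<forall>u\<in>span (range e). (\<forall>v. polar Q u v = 0) \<longrightarrow> u = 0"
    using Q U(3) unfolding re \<open>span S = U\<close> nondegenerate_quadratic_form_def totally_singular_def by blast
  have ee: "polar Q (e i) (e j) = 0" for i j using iso eU by blast
  have Qe: "Q (e i) = 0" for i using eU U(3) by (simp add: totally_singular_def)
  obtain f' where f': "\<And>i j. polar Q (e i) (f' j) = (if i = j then 1 else 0)" "\<And>i j. polar Q (f' i) (f' j) = 0"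
    using dual_isotropic_family[OF \<open>inj e\<close> _ ee nd] S(2) re by blast
  \<comment> \<open>Adding this multiple of \<open>e j\<close> changes \<open>Q (f' j)\<close> by
    itself, giving 0, and preserves all pairings.\<close>
  define f where "f j = f' j + scale (Q (f' j)) (e j)" for j
  have f'e: "polar Q (f' i) (e j) = (if i = j then 1 else 0)" for i j
    unfolding B_sym[of "f' i"] f' by auto
  have ef: "polar Q (e i) (f j) = (if i = j then 1 else 0)" for i j
    by (simp add: f_def B_add_right B_scale_right ee f')
  have ff: "polar Q (f i) (f j) = 0" for i j
    by (simp add: f_def B_add_left B_add_right B_scale_left B_scale_right ee f' f'e)
  have Qf: "Q (f i) = 0" for i
    by (simp add: f_def Q_add quad(1) Qe B_scale_right f'e)
  have "dim (UNIV :: 'v set) = 2 * CARD(4)" using dim by simp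
  note hc = hyperbolic_coordinates[OF ee ff ef this]
  define emb where "emb = hyperbolic_sum e f"
  note hc = hc[folded emb_def]
  have "Q (emb a b) = dot a b" for a b
  proof -
    have "Q (emb a 0) = 0" "Q (emb 0 b) = 0"
      using Q_sum[of f] Q_sum[of e] Qe Qf ee ff by (simp_all add: emb_def hyperbolic_sum_def)
    moreover have "emb a b = emb a 0 + emb 0 b" unfolding hc(1) by simp
    ultimately show ?thesis by (simp add: Q_add hc(3))
  qed
  hence frame: "hyperbolic_8_space scale Q emb"
    by unfold_locales (use hc in auto)
  interpret hyperbolic_8_space scale Q emb by (rule frame)
  have "emb 0 b \<in> U" for b
    using eU U(1) by (simp add: emb_def hyperbolic_sum_def subspace_sum subspace_scale)
  hence "winf \<subseteq> U" unfolding winf_def by blast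
  moreover have "card winf = card U"
    using dim_eq_iff_card[OF subspace_winf finite_subset_space, of 4]
      dim_eq_iff_card[OF U(1) finite_subset_space, of 4] dim_winf U(2) by simp
  ultimately have "winf = U" by (intro card_subset_eq) simp_all
  thus ?thesis using that[OF frame] by (simp add: winf_def)
qed

section \<open>The partial spread\<close>

text \<open>Triples become matrices with \<open>g = h = r\<close> and \<open>u = w = 0\<close>, so
  the Pfaffian of a difference is the polar form of the points; \<open>winf\<close> adds one
  member.\<close>

lemma suzuki_spread:
  fixes scale :: "'k::{field,finite} \<Rightarrow> 'v::ab_group_add \<Rightarrow> 'v" and emb :: "'k ^ 4 \<Rightarrow> 'k ^ 4 \<Rightarrow> 'v"
  assumes "suzuki_field TYPE('k) e n" and "hyperbolic_8_space scale Q emb" and s: "0 < s" "s < n"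
  obtains \<Sigma> where "maximal_orthogonal_partial_spread scale Q \<Sigma>" "range (emb 0) \<in> \<Sigma>"
    "int (card \<Sigma>) = (int CARD('k))\<^sup>2 - int s * int CARD('k) + 2 * int s - 1"
proof -
  interpret suzuki_field "TYPE('k)" e n by fact
  interpret hyperbolic_8_space scale Q emb by fact
  have "s \<le> CARD('k)" using s(2) n_ge_2 by (simp add: card_eq) (metis le_square le_trans less_imp_le mult_2 trans_le_add1 mult.assoc)
  then obtain Ms :: "'k set" where Ms: "card Ms = s"
    by (metis obtain_subset_with_card_n)
  have "Ms \<noteq> {}" using Ms s(1) by auto
  define S where "S = ovoid_part Ms \<union> replacement_part Ms"
  let ?m = "\<lambda>(x, y, r). alt_matrix x y r r 0 0"
  define \<Sigma> where "\<Sigma> = insert winf (graph ` ?m ` S)"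
  have "maximal_orthogonal_partial_spread scale Q \<Sigma>"
    unfolding \<Sigma>_def
  proof (rule maximal_partial_spread_graphs)
    show "alternating_matrix M" if "M \<in> ?m ` S" for M
      using that alternating_alt_matrix by auto
    show "pfaffian (M + N) \<noteq> 0" if MN: "M \<in> ?m ` S" "N \<in> ?m ` S" "M \<noteq> N" for M N
    proof -
      obtain x y r x' y' r' where M: "(x, y, r) \<in> S" "M = alt_matrix x y r r 0 0"
        and N: "(x', y', r') \<in> S" "N = alt_matrix x' y' r' r' 0 0"
        using MN(1,2) by auto
      hence "(x + x') * (y + y') + (r + r')\<^sup>2 \<noteq> 0"
        using MN(3) unfolding S_def by (intro parts_pairwise) auto
      thus ?thesis by (simp only: M(2) N(2) alt_matrix_add pfaffian_alt_matrix power2_eq_square) simp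
    qed
    show "\<exists>N\<in>?m ` S. pfaffian (M + N) = 0" if M: "alternating_matrix M" for M
    proof -
      obtain x' y' g h u w where M: "M = alt_matrix x' y' g h u w"
        using M by (rule alternating_matrixE)
      obtain x y r where xyr: "(x, y, r) \<in> S" "(x' + x) * (y' + y) + (g + r) * (h + r) + u * w = 0"
        using parts_maximal[of Ms x' y' g h u w] \<open>Ms \<noteq> {}\<close> Ms s(2) unfolding S_def by auto
      have "pfaffian (M + alt_matrix x y r r 0 0) = 0"
        unfolding M alt_matrix_add pfaffian_alt_matrix using xyr(2) by simp
      thus ?thesis using xyr(1) by force
    qed
  qed
  moreover have "int (card \<Sigma>) = (int CARD('k))\<^sup>2 - int s * int CARD('k) + 2 * int s - 1"
  proof -
    have "emb 0 (axis 1 1) \<in> winf" "emb 0 (axis 1 1) \<notin> graph M" for M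
      by (simp_all add: axis_eq_0_iff)
    hence "winf \<notin> graph ` ?m ` S" by blast
    moreover have "inj_on ?m S" by (auto simp: inj_on_def)
    moreover have "inj_on graph (?m ` S)" by (auto simp: inj_on_def)
    moreover have "finite S" by simp
    ultimately have "card \<Sigma> = Suc (card S)" unfolding \<Sigma>_def by (simp add: card_image)
    moreover have "card S + s * (CARD('k) - 1) + 2 = CARD('k)\<^sup>2 + s"
      using card_parts[OF \<open>Ms \<noteq> {}\<close>] unfolding Ms S_def .
    from arg_cong[OF this, of int]
    have "int (card S) + int (s * (CARD('k) - 1)) + 2 = (int CARD('k))\<^sup>2 + int s"
      by (simp only: of_nat_add of_nat_power of_nat_numeral)
    moreover have "int (s * (CARD('k) - 1)) = int s * int CARD('k) - int s"
      using card_k_gt_1 by (simp add: of_nat_diff algebra_simps)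
    ultimately show ?thesis by linarith
  qed
  ultimately show ?thesis using that by (simp add: \<Sigma>_def winf_def)
qed

lemma suzuki_spread_symplectic:
  fixes scale :: "'k::{field,finite} \<Rightarrow> 'v::ab_group_add \<Rightarrow> 'v" and emb :: "'k ^ 4 \<Rightarrow> 'k ^ 4 \<Rightarrow> 'v"
  assumes "suzuki_field TYPE('k) e n" and "hyperbolic_8_space scale Q emb"
    and "maximal_orthogonal_partial_spread scale Q \<Sigma>" and "range (emb 0) \<in> \<Sigma>"
  shows "maximal_symplectic_partial_spread scale (polar Q) \<Sigma>"
proof -
  interpret suzuki_field "TYPE('k)" e n by fact
  interpret hyperbolic_8_space scale Q emb by fact
  have "\<exists>y. y\<^sup>2 = x" for x :: 'k using \<theta>_\<theta>_sq by blast
  thus ?thesis using assms(3,4) by (intro maximal_orthogonal_imp_symplectic) (simp_all add: winf_def)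
qed

lemma (in O_plus_8_space) singular_4_space:
  obtains U where "subspace U" "dim U = 4" "totally_singular Q U"
proof -
  interpret finite_field_space scale ..
  have fin: "finite (UNIV :: 'v set)" by (rule finite_of_dim_pos) (simp add: dim_space)
  let ?D = "{dim U | U. subspace U \<and> totally_singular Q U}"
  have "?D \<subseteq> range dim" by blast
  moreover have "finite (range (dim :: 'v set \<Rightarrow> nat))"
    using fin by (metis Finite_Set.finite_set finite_imageI)
  ultimately have "finite ?D" by (rule finite_subset)
  moreover have "Q 0 = 0"
  proof -
    have "Q (scale 0 0) = 0\<^sup>2 * Q 0"
      using nondegenerate_form unfolding nondegenerate_quadratic_form_def quadratic_form_def by blast
    thus ?thesis by simp
  qed
  hence "subspace {0} \<and> totally_singular Q {0}" by (simp add: totally_singular_def)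
  hence "?D \<noteq> {}" by blast
  ultimately have "Max ?D \<in> ?D" by (rule Max_in)
  moreover have "Max ?D = 4" using plus dim_space by (simp add: plus_type_def witt_index_def)
  ultimately show ?thesis using that by auto
qed

theorem theorem7p14:
  fixes scaleV :: "'k::{field,finite} \<Rightarrow> 'v::ab_group_add \<Rightarrow> 'v" and Q :: "'v \<Rightarrow> 'k"
    and scaleW :: "'k \<Rightarrow> 'w::ab_group_add \<Rightarrow> 'w" and B :: "'w \<Rightarrow> 'w \<Rightarrow> 'k"
    and q e :: nat
  assumes q: "q = 2 ^ (2 * e + 1)" "q > 2"
  shows
    "(O_plus_8_space scaleV q Q \<longrightarrow>
       (\<forall>s::int. 1 < s \<and> real_of_int s \<le> sqrt (real q / 2) - 1 \<longrightarrow>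
         (\<exists>\<Sigma>. maximal_orthogonal_partial_spread scaleV Q \<Sigma> \<and>
              int (card \<Sigma>) = (int q)\<^sup>2 - s * int q + 2 * s - 1) \<and>
         (\<forall>\<Sigma>. maximal_orthogonal_partial_spread scaleV Q \<Sigma> \<and>
              int (card \<Sigma>) = (int q)\<^sup>2 - s * int q + 2 * s - 1 \<longrightarrow>
              maximal_symplectic_partial_spread scaleV (polar Q) \<Sigma>))) \<and>
     (Sp_8_space scaleW q B \<longrightarrow>
       (\<exists>\<Sigma>. maximal_symplectic_partial_spread scaleW B \<Sigma> \<and>
            real (card \<Sigma>) =
              (real q)\<^sup>2 - sqrt ((real q) ^ 3 / 2) + real q + sqrt (2 * real q) - 3))"
proof -
  define n :: nat where "n = 2 ^ e"
  have "e > 0" using q by (cases e) auto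
  have qn: "q = 2 * n * n" unfolding q(1) n_def by (simp add: power_add mult_2 distrib_right)
  have "n \<ge> 2" using \<open>e > 0\<close> power_increasing[of 1 e "2::nat"] by (simp add: n_def)
  have suzuki: "suzuki_field TYPE('k) e n" if "CARD('k) = q"
    using that q(1) \<open>e > 0\<close> n_def by unfold_locales simp_all
  have two: "(2::'k) = 0" if "CARD('k) = q"
  proof -
    interpret suzuki_field "TYPE('k)" e n by (rule suzuki[OF that])
    show ?thesis by simp
  qed
  show ?thesis
  proof (intro conjI impI allI; (elim conjE)?)
    fix s :: int
    assume O: "O_plus_8_space scaleV q Q" and s: "1 < s" "real_of_int s \<le> sqrt (real q / 2) - 1"
    interpret O_plus_8_space scaleV q Q by (rule O)
    interpret finite_field_space scaleV ..
    note frame = orthogonal_frame[OF two[OF card_field] nondegenerate_form dim_space]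
    have "real q / 2 = (real n)\<^sup>2" by (simp add: qn power2_eq_square)
    hence "sqrt (real q / 2) = real n" by simp
    \<comment> \<open>As \<open>sqrt (q / 2)\<close> is the integer \<open>n\<close>, the bound on
      \<open>s\<close> is exactly what the construction requires.\<close>
    hence "s < int n" using s(2) by linarith
    define t where "t = nat s"
    have t: "s = int t" "0 < t" "t < n" using s(1) \<open>s < int n\<close> by (auto simp: t_def)
    {
      obtain U where U: "subspace U" "dim U = 4" "totally_singular Q U" by (rule singular_4_space)
      obtain emb where emb: "hyperbolic_8_space scaleV Q emb" by (rule frame[OF U])
      obtain \<Sigma> where "maximal_orthogonal_partial_spread scaleV Q \<Sigma>"
        "int (card \<Sigma>) = (int CARD('k))\<^sup>2 - int t * int CARD('k) + 2 * int t - 1"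
        using suzuki_spread[OF suzuki[OF card_field] emb t(2,3)] by blast
      thus "\<exists>\<Sigma>. maximal_orthogonal_partial_spread scaleV Q \<Sigma> \<and>
        int (card \<Sigma>) = (int q)\<^sup>2 - s * int q + 2 * s - 1"
        unfolding card_field t(1) by blast
    }
    fix \<Sigma>
    assume max: "maximal_orthogonal_partial_spread scaleV Q \<Sigma>"
      and card: "int (card \<Sigma>) = (int q)\<^sup>2 - s * int q + 2 * s - 1"
    \<comment> \<open>The prescribed size is positive, so there is a member to place at
      infinity.\<close>
    have "n \<le> q" by (simp add: qn)
    hence "s * int q \<le> int q * int q" using \<open>s < int n\<close> by (intro mult_right_mono) simp_all
    hence "card \<Sigma> > 0" using card s(1) by (simp add: power2_eq_square)
    hence "\<Sigma> \<noteq> {}" by auto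
    then obtain U where U: "U \<in> \<Sigma>" by blast
    hence "subspace U" "dim U = 4" "totally_singular Q U"
      using max unfolding maximal_orthogonal_partial_spread_def orthogonal_partial_spread_def by blast+
    then obtain emb where "hyperbolic_8_space scaleV Q emb" "range (emb 0) = U" by (rule frame)
    thus "maximal_symplectic_partial_spread scaleV (polar Q) \<Sigma>"
      using suzuki_spread_symplectic[OF suzuki[OF card_field] _ max] U by simp
  next
    assume Sp: "Sp_8_space scaleW q B"
    interpret Sp_8_space scaleW q B by (rule Sp)
    interpret symplectic_space scaleW B
      by unfold_locales (rule two[OF card_field] bilinear alternating_form)+
    obtain Q :: "'w \<Rightarrow> 'k" and emb where emb: "hyperbolic_8_space scaleW Q emb" "polar Q = B"
      using symplectic_frame[OF nondegenerate_form dim_space] .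
    \<comment> \<open>The largest possible number of circles is used; for \<open>q = 8\<close> it is
      1, which lies outside the range of the first claim.\<close>
    obtain \<Sigma> where \<Sigma>: "maximal_orthogonal_partial_spread scaleW Q \<Sigma>" "range (emb 0) \<in> \<Sigma>"
      "int (card \<Sigma>) = (int CARD('k))\<^sup>2 - int (n - 1) * int CARD('k) + 2 * int (n - 1) - 1"
      using suzuki_spread[OF suzuki[OF card_field] emb(1), of "n - 1"] \<open>n \<ge> 2\<close> by auto
    have "maximal_symplectic_partial_spread scaleW B \<Sigma>"
      using suzuki_spread_symplectic[OF suzuki[OF card_field] emb(1) \<Sigma>(1,2)] emb(2) by simp
    moreover have "real (card \<Sigma>) = (real q)\<^sup>2 - sqrt ((real q) ^ 3 / 2) + real q + sqrt (2 * real q) - 3"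
    proof -
      have "real q ^ 3 / 2 = (real n * real q)\<^sup>2" "2 * real q = (2 * real n)\<^sup>2"
        by (simp_all add: qn power2_eq_square power3_eq_cube)
      hence "sqrt (real q ^ 3 / 2) = real n * real q" "sqrt (2 * real q) = 2 * real n"
        by (simp_all only: real_sqrt_abs) simp_all
      moreover have "real (card \<Sigma>) = real_of_int (int (card \<Sigma>))" by simp
      hence "real (card \<Sigma>) = (real q)\<^sup>2 - (real n - 1) * real q + 2 * (real n - 1) - 1"
        unfolding \<Sigma>(3) card_field using \<open>n \<ge> 2\<close> by (simp add: of_nat_diff)
      ultimately show ?thesis by (simp add: algebra_simps)
    qed
    ultimately show "\<exists>\<Sigma>. maximal_symplectic_partial_spread scaleW B \<Sigma> \<and>
      real (card \<Sigma>) = (real q)\<^sup>2 - sqrt ((real q) ^ 3 / 2) + real q + sqrt (2 * real q) - 3" by blast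
  qed
qed

end
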